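(* Given any $\epsilon>0$ there exists a positive integer $k$ such that the entanglement gap per bond for an arbitrary coupling Hamiltonian on any bipartite lattice with coordination number $k$ is less than $\epsilon$.
   Context: Finite-dimensional quantum systems (spins) sit at the vertices (sites) of a graph or lattice, and each edge, called a bond, represents an interaction between the spins at its two ends. The Hamiltonian is $H=\sum_{\langle i,j\rangle}H_{ij}$, the sum running over all bonds, where the coupling Hamiltonian $H_{ij}$ is a Hermitian operator acting on spins $i$ and $j$ and as the identity on all other spins; the coupling Hamiltonians on all bonds are taken to be equal, and the lattice has translational symmetry. The lattice is bipartite if its vertices can be divided into two sets $A$ and $B$ such that edges only connect vertices of $A$ with vertices of $B$. The coordination number of a lattice is the number of edges incident on each site. A state of the whole system is separable if it is a convex combination of pure product states over all sites. The entanglement gap is $G_E=E_{\mathrm{sep}}-E_0$, where $E_0$ is the ground-state energy of $H$ and $E_{\mathrm{sep}}$ is the minimum of $\mathrm{tr}[H\rho]$ over separable states $\rho$. The entanglement gap per bond is $G_E/N$, with $N$ the total number of bonds (this per-bond quantity is regarded as well defined also for lattices with $N\to\infty$).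
   Formalization: The integer k depends on ε, on the local spin dimension and on a bound M on the norm of the coupling Hamiltonian (uniformly over all such couplings and lattices); with k depending on ε alone the claim fails, by rescaling the coupling or by letting the spin dimension grow. *)

theory Defs
  imports "HOL-Analysis.Analysis"
begin

section \<open>Lattices\<close>

text \<open>
  Sites are labelled by natural numbers, which covers every finite graph and every countably
  infinite one. The labelling type cannot be a type variable: the size of the lattice has to be
  quantified inside a formula.
\<close>

record lattice =
  sites :: "nat set"
  bonds :: "nat set set"

definition simple_graph :: "lattice \<Rightarrow> bool" where
  "simple_graph L \<longleftrightarrow> (\<forall>e\<in>bonds L. e \<subseteq> sites L \<and> card e = 2)"

definition bipartition :: "lattice \<Rightarrow> nat set \<Rightarrow> nat set \<Rightarrow> bool" where
  "bipartition L A B \<longleftrightarrow>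
     A \<union> B = sites L \<and> A \<inter> B = {} \<and> (\<forall>e\<in>bonds L. \<exists>a\<in>A. \<exists>b\<in>B. e = {a, b})"

definition coordination_number :: "lattice \<Rightarrow> nat \<Rightarrow> bool" where
  "coordination_number L k \<longleftrightarrow>
     (\<forall>v\<in>sites L. finite {e \<in> bonds L. v \<in> e} \<and> card {e \<in> bonds L. v \<in> e} = k)"

definition induced_sublattice :: "lattice \<Rightarrow> nat set \<Rightarrow> lattice" where
  "induced_sublattice L R = \<lparr>sites = sites L \<inter> R, bonds = {e \<in> bonds L. e \<subseteq> R}\<rparr>"

definition boundary_bonds :: "lattice \<Rightarrow> nat set \<Rightarrow> nat set set" where
  "boundary_bonds L R = {e \<in> bonds L. e \<inter> R \<noteq> {} \<and> \<not> e \<subseteq> R}"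

text \<open>
  The finite regions along which the thermodynamic limit of an infinite lattice is taken
  (e.g. growing boxes in a hypercubic lattice): they exhaust the lattice and their boundary is
  negligible compared with their volume.
\<close>

definition van_hove_exhaustion :: "lattice \<Rightarrow> (nat \<Rightarrow> nat set) \<Rightarrow> bool" where
  "van_hove_exhaustion L R \<longleftrightarrow>
     (\<forall>n. finite (R n) \<and> R n \<subseteq> sites L) \<and>
     (\<forall>v\<in>sites L. \<forall>\<^sub>F n in sequentially. v \<in> R n) \<and>
     (\<lambda>n. real (card (boundary_bonds L (R n))) / real (card (R n))) \<longlonglongrightarrow> 0"

section \<open>Operators and states\<close>

text \<open>
  A spin is the space \<open>complex ^ 'd\<close>, of dimension \<open>CARD('d)\<close>. The state space of a finite lattice
  consists of the complex functions on its configurations (the standard product basis), and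
  operators are given by their matrix entries in that basis. Values outside the set of
  configurations are irrelevant.
\<close>

definition configs :: "lattice \<Rightarrow> (nat \<Rightarrow> 'd::finite) set" where
  "configs L = sites L \<rightarrow>\<^sub>E UNIV"

type_synonym 'd op = "(nat \<Rightarrow> 'd) \<Rightarrow> (nat \<Rightarrow> 'd) \<Rightarrow> complex"

definition hermitian_matrix :: "complex ^ 'n ^ 'n \<Rightarrow> bool" where
  "hermitian_matrix h \<longleftrightarrow> (\<forall>i j. h $ i $ j = cnj (h $ j $ i))"

text \<open>The operator \<open>h\<close> on the spins \<open>a\<close> (first factor) and \<open>b\<close>, tensored with the identity
  on all other spins.\<close>

definition coupling ::
    "complex ^ ('d::finite \<times> 'd) ^ ('d \<times> 'd) \<Rightarrow> lattice \<Rightarrow> nat \<Rightarrow> nat \<Rightarrow> 'd op" where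
  "coupling h L a b x y =
     (if \<forall>v \<in> sites L - {a, b}. x v = y v then h $ (x a, x b) $ (y a, y b) else 0)"

text \<open>
  All couplings are equal to the same \<open>h\<close>. As \<open>h\<close> need not be invariant under exchange of the two
  spins, the first factor is always placed on the endpoint in the sublattice \<open>A\<close>; for an
  exchange-invariant \<open>h\<close> this choice is immaterial.
\<close>

definition hamiltonian ::
    "complex ^ ('d::finite \<times> 'd) ^ ('d \<times> 'd) \<Rightarrow> nat set \<Rightarrow> lattice \<Rightarrow> 'd op" where
  "hamiltonian h A L x y =
     (\<Sum>(a, b) \<in> {(a, b). {a, b} \<in> bonds L \<and> a \<in> A \<and> b \<notin> A}. coupling h L a b x y)"

definition is_energy_eigenvalue :: "lattice \<Rightarrow> ('d::finite) op \<Rightarrow> real \<Rightarrow> bool" where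
  "is_energy_eigenvalue L H E \<longleftrightarrow>
     (\<exists>\<psi>. (\<exists>x\<in>configs L. \<psi> x \<noteq> 0) \<and>
          (\<forall>x\<in>configs L. (\<Sum>y\<in>configs L. H x y * \<psi> y) = complex_of_real E * \<psi> x))"

definition ground_energy :: "lattice \<Rightarrow> ('d::finite) op \<Rightarrow> real" where
  "ground_energy L H = Inf {E. is_energy_eigenvalue L H E}"

definition product_vector ::
    "lattice \<Rightarrow> (nat \<Rightarrow> complex ^ 'd::finite) \<Rightarrow> (nat \<Rightarrow> 'd) \<Rightarrow> complex" where
  "product_vector L \<phi> x = (\<Prod>v\<in>sites L. \<phi> v $ x v)"

definition separable :: "lattice \<Rightarrow> ('d::finite) op \<Rightarrow> bool" where
  "separable L \<rho> \<longleftrightarrow>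
     (\<exists>(m::nat) (p :: nat \<Rightarrow> real) (\<phi> :: nat \<Rightarrow> nat \<Rightarrow> complex ^ 'd).
        (\<forall>i<m. 0 \<le> p i) \<and> (\<Sum>i<m. p i) = 1 \<and>
        (\<forall>i<m. \<forall>v\<in>sites L. norm (\<phi> i v) = 1) \<and>
        (\<forall>x\<in>configs L. \<forall>y\<in>configs L.
           \<rho> x y = (\<Sum>i<m. complex_of_real (p i) *
                       (product_vector L (\<phi> i) x * cnj (product_vector L (\<phi> i) y)))))"

text \<open>\<open>tr[H \<rho>]\<close>, which is real for Hermitian \<open>H\<close> and \<open>\<rho>\<close>.\<close>

definition energy :: "lattice \<Rightarrow> ('d::finite) op \<Rightarrow> 'd op \<Rightarrow> real" where
  "energy L H \<rho> = Re (\<Sum>x\<in>configs L. \<Sum>y\<in>configs L. H x y * \<rho> y x)"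

definition separable_energy :: "lattice \<Rightarrow> ('d::finite) op \<Rightarrow> real" where
  "separable_energy L H = Inf {energy L H \<rho> | \<rho>. separable L \<rho>}"

definition entanglement_gap :: "lattice \<Rightarrow> ('d::finite) op \<Rightarrow> real" where
  "entanglement_gap L H = separable_energy L H - ground_energy L H"

definition gap_per_bond ::
    "complex ^ ('d::finite \<times> 'd) ^ ('d \<times> 'd) \<Rightarrow> nat set \<Rightarrow> lattice \<Rightarrow> real" where
  "gap_per_bond h A L = entanglement_gap L (hamiltonian h A L) / real (card (bonds L))"

end

theory Submission
  imports Defs "Jordan_Normal_Form.Spectral_Radius"
begin

text \<open>
  Let \<open>e\<close> be the separable energy per bond. As all couplings are equal and the lattice is bipartite,
  no product of two pure states has energy below \<open>e\<close> with respect to \<open>h\<close>: putting one of the states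
  on \<open>A\<close> and the other on \<open>B\<close> gives a product state of the whole lattice. The Hamiltonian is a sum
  of stars, each consisting of a site of \<open>A\<close> and its neighbours. By monogamy of entanglement the
  centre of a star can be strongly correlated with only boundedly many leaves after suitable
  measurements on them: every measurement of a strongly correlated leaf raises the mean purity of the
  centre by a fixed amount. The other leaves see a mixture of almost product states, so a star with
  \<open>m\<close> leaves has energy at least \<open>m * (e - \<delta>) - C\<close>, where \<open>C\<close> does not depend on \<open>m\<close>. Summing over
  the stars, the gap per bond is at most \<open>\<delta> + C / k\<close> up to boundary terms.
\<close>

no_notation vec_index (infixl "$" 100)

section \<open>Real eigenvalues of finite Hermitian matrices\<close>

lemma of_real_cmod_power2: "(complex_of_real (cmod z))\<^sup>2 = z * cnj z"
  by (simp flip: complex_norm_square)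

text \<open>Without an eigenvalue, \<open>ground_energy\<close> would be the infimum of the empty
  set. Numbering \<open>S\<close> turns \<open>H\<close> into a complex matrix, whose spectrum is
  nonempty; Hermitian symmetry makes the eigenvalue real.\<close>

lemma hermitian_eigenvalue_exists:
  fixes H :: "'a \<Rightarrow> 'a \<Rightarrow> complex"
  assumes fin: "finite S" and ne: "S \<noteq> {}"
    and herm: "\<And>x y. x \<in> S \<Longrightarrow> y \<in> S \<Longrightarrow> H x y = cnj (H y x)"
  shows "\<exists>E \<psi>. (\<exists>x\<in>S. \<psi> x \<noteq> 0) \<and> (\<forall>x\<in>S. (\<Sum>y\<in>S. H x y * \<psi> y) = complex_of_real E * \<psi> x)"
proof -
  obtain f where f: "bij_betw f {0..<card S} S"
    using ex_bij_betw_nat_finite[OF fin] by blast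
  define g where "g = the_inv_into {0..<card S} f"
  have g: "f (g x) = x" "g x < card S" if "x \<in> S" for x
    using f that f_the_inv_into_f_bij_betw[OF f] bij_betwE[OF bij_betw_the_inv_into[OF f]]
    unfolding g_def by fastforce+
  have gf: "g (f i) = i" if "i < card S" for i
    using f that unfolding g_def by (simp add: bij_betw_def the_inv_into_f_f)
  define A where "A = mat (card S) (card S) (\<lambda>(i,j). H (f i) (f j))"
  have A: "A \<in> carrier_mat (card S) (card S)" unfolding A_def by simp
  have "card S > 0" using fin ne by (simp add: card_gt_0_iff)
  from spectrum_non_empty[OF A this] obtain l where "eigenvalue A l"
    unfolding spectrum_def by auto
  then obtain v where v: "v \<in> carrier_vec (card S)" "v \<noteq> 0\<^sub>v (card S)" "A *\<^sub>v v = l \<cdot>\<^sub>v v"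
    using A unfolding eigenvalue_def eigenvector_def by auto
  define \<psi> where "\<psi> x = vec_index v (g x)" for x
  have eig: "(\<Sum>y\<in>S. H x y * \<psi> y) = l * \<psi> x" if x: "x \<in> S" for x
  proof -
    have "(\<Sum>y\<in>S. H x y * \<psi> y) = (\<Sum>j\<in>{0..<card S}. H x (f j) * \<psi> (f j))"
      using sum.reindex_bij_betw[OF f, of "\<lambda>y. H x y * \<psi> y"] by simp
    also have "\<dots> = (\<Sum>j\<in>{0..<card S}. H (f (g x)) (f j) * vec_index v j)"
      using x by (intro sum.cong) (auto simp: \<psi>_def gf g)
    also have "\<dots> = vec_index (A *\<^sub>v v) (g x)"
      using g(2)[OF x] v(1) by (simp add: A_def scalar_prod_def)
    also have "\<dots> = l * \<psi> x"
      using v g(2)[OF x] by (simp add: \<psi>_def)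
    finally show ?thesis .
  qed
  have "\<exists>i<card S. vec_index v i \<noteq> 0" using v(1,2) by (metis carrier_vecD eq_vecI index_zero_vec)
  then obtain i where i: "i < card S" "vec_index v i \<noteq> 0" by blast
  then have nz: "\<psi> (f i) \<noteq> 0" "f i \<in> S"
    using f by (auto simp: \<psi>_def gf bij_betw_def)
  \<comment> \<open>The quadratic form of \<open>H\<close> at \<psi> equals \<open>l * n\<close>,
    where \<open>n\<close> is the squared norm. Conjugation followed by an exchange of the two sums
    leaves the form unchanged, so \<open>l\<close> is real because \<open>n\<close> is
    nonzero.\<close>
  define n where "n = (\<Sum>x\<in>S. (cmod (\<psi> x))\<^sup>2)"
  have n: "n \<noteq> 0"
    using nz fin unfolding n_def by (subst sum_nonneg_eq_0_iff) auto
  have q: "(\<Sum>x\<in>S. cnj (\<psi> x) * (\<Sum>y\<in>S. H x y * \<psi> y)) = l * complex_of_real n"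
    unfolding n_def of_real_sum sum_distrib_left[of l]
  proof (rule sum.cong)
    fix x assume "x \<in> S"
    from eig[OF this] show "cnj (\<psi> x) * (\<Sum>y\<in>S. H x y * \<psi> y) = l * complex_of_real ((cmod (\<psi> x))\<^sup>2)"
      by (simp add: of_real_cmod_power2)
  qed simp
  have "cnj (\<Sum>x\<in>S. cnj (\<psi> x) * (\<Sum>y\<in>S. H x y * \<psi> y))
      = (\<Sum>x\<in>S. \<Sum>y\<in>S. cnj (\<psi> y) * (H y x * \<psi> x))"
    by (auto simp: sum_distrib_left herm[symmetric] ac_simps intro!: sum.cong)
  also have "\<dots> = (\<Sum>x\<in>S. cnj (\<psi> x) * (\<Sum>y\<in>S. H x y * \<psi> y))"
    by (subst sum.swap) (simp add: sum_distrib_left)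
  finally have "cnj l * n = l * n" unfolding q by simp
  with n have "cnj l = l" by simp
  then have "l = complex_of_real (Re l)" by (simp add: complex_eq_iff)
  with eig nz show ?thesis by metis
qed

section \<open>State vectors and operators on single sites\<close>

definition inner_product ::
    "lattice \<Rightarrow> ((nat \<Rightarrow> 'd::finite) \<Rightarrow> complex) \<Rightarrow> ((nat \<Rightarrow> 'd) \<Rightarrow> complex) \<Rightarrow> complex" where
  "inner_product L \<phi> \<psi> = (\<Sum>x\<in>configs L. cnj (\<phi> x) * \<psi> x)"

text \<open>The squared norm. Vectors stay unnormalised throughout, so after a measurement the
  weight of a branch, relative to the original weight, is its probability.\<close>

definition weight :: "lattice \<Rightarrow> ((nat \<Rightarrow> 'd::finite) \<Rightarrow> complex) \<Rightarrow> real" where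
  "weight L \<psi> = (\<Sum>x\<in>configs L. (cmod (\<psi> x))\<^sup>2)"

text \<open>A map on vectors rather than a kernel of type \<open>op\<close>: operators at different
  sites then commute by exchanging two sums over \<open>'d\<close>, with no sum over
  configurations.\<close>

definition site_op ::
    "nat \<Rightarrow> ('d::finite \<Rightarrow> 'd \<Rightarrow> complex) \<Rightarrow> ((nat \<Rightarrow> 'd) \<Rightarrow> complex) \<Rightarrow> (nat \<Rightarrow> 'd) \<Rightarrow> complex" where
  "site_op v m \<psi> x = (\<Sum>j\<in>UNIV. m (x v) j * \<psi> (x(v := j)))"

definition munit :: "'d \<Rightarrow> 'd \<Rightarrow> 'd \<Rightarrow> 'd \<Rightarrow> complex" where
  "munit i j = (\<lambda>p q. if p = i \<and> q = j then 1 else 0)"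

text \<open>For a unit vector \<open>u\<close> this is the orthogonal projection onto
  \<open>u\<close>, which serves as one outcome of a measurement with two outcomes.\<close>

definition ketbra :: "('d \<Rightarrow> complex) \<Rightarrow> 'd \<Rightarrow> 'd \<Rightarrow> complex" where
  "ketbra u = (\<lambda>p q. u p * cnj (u q))"

lemma site_op_munit: "site_op v (munit i j) \<psi> x = (if x v = i then \<psi> (x(v := j)) else 0)"
  by (simp add: site_op_def munit_def if_distrib[of "\<lambda>z. z * _"] cong: if_cong)

lemma site_op_diff: "site_op v m (\<lambda>x. \<phi> x - \<psi> x) = (\<lambda>x. site_op v m \<phi> x - site_op v m \<psi> x)"
  by (simp add: site_op_def fun_eq_iff right_diff_distrib sum_subtractf)

lemma site_op_commute:
  assumes "a \<noteq> b"
  shows "site_op a m (site_op b n \<psi>) = site_op b n (site_op a m \<psi>)"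
proof
  fix x
  have "site_op a m (site_op b n \<psi>) x
      = (\<Sum>i\<in>UNIV. \<Sum>j\<in>UNIV. m (x a) i * (n (x b) j * \<psi> (x(a := i, b := j))))"
    using assms by (simp add: site_op_def sum_distrib_left)
  also have "\<dots> = (\<Sum>j\<in>UNIV. \<Sum>i\<in>UNIV. n (x b) j * (m (x a) i * \<psi> (x(b := j, a := i))))"
    using assms by (subst sum.swap) (simp add: fun_upd_twist ac_simps)
  also have "\<dots> = site_op b n (site_op a m \<psi>) x"
    using assms by (simp add: site_op_def sum_distrib_left)
  finally show "site_op a m (site_op b n \<psi>) x = site_op b n (site_op a m \<psi>) x" .
qed

lemma site_op_compose:
  "site_op v m (site_op v n \<psi>) = site_op v (\<lambda>p q. \<Sum>r\<in>UNIV. m p r * n r q) \<psi>"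
proof
  fix x
  have "site_op v m (site_op v n \<psi>) x
      = (\<Sum>i\<in>UNIV. \<Sum>j\<in>UNIV. m (x v) i * n i j * \<psi> (x(v := j)))"
    by (simp add: site_op_def sum_distrib_left ac_simps)
  also have "\<dots> = (\<Sum>j\<in>UNIV. \<Sum>i\<in>UNIV. m (x v) i * n i j * \<psi> (x(v := j)))"
    by (rule sum.swap)
  finally show "site_op v m (site_op v n \<psi>) x
      = site_op v (\<lambda>p q. \<Sum>r\<in>UNIV. m p r * n r q) \<psi> x"
    by (simp add: site_op_def sum_distrib_right)
qed

lemma site_op_ketbra_idem:
  assumes "(\<Sum>j\<in>UNIV. (cmod (u j))\<^sup>2) = 1"
  shows "site_op v (ketbra u) (site_op v (ketbra u) \<psi>) = site_op v (ketbra u) \<psi>"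
proof -
  have "(\<Sum>r\<in>UNIV. ketbra u p r * ketbra u r q) = ketbra u p q" for p q
  proof -
    have "(\<Sum>r\<in>UNIV. ketbra u p r * ketbra u r q)
        = u p * cnj (u q) * complex_of_real (\<Sum>r\<in>UNIV. (cmod (u r))\<^sup>2)"
      by (simp add: ketbra_def sum_distrib_left of_real_cmod_power2 ac_simps)
    then show ?thesis by (simp add: assms ketbra_def)
  qed
  then show ?thesis by (simp add: site_op_compose)
qed

lemma inner_product_diff_right:
  "inner_product L \<phi> (\<lambda>x. \<psi> x - \<theta> x) = inner_product L \<phi> \<psi> - inner_product L \<phi> \<theta>"
  by (simp add: inner_product_def right_diff_distrib sum_subtractf)

lemma inner_product_diff_left:
  "inner_product L (\<lambda>x. \<psi> x - \<theta> x) \<phi> = inner_product L \<psi> \<phi> - inner_product L \<theta> \<phi>"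
  by (simp add: inner_product_def left_diff_distrib sum_subtractf)

lemma inner_product_self: "inner_product L \<psi> \<psi> = complex_of_real (weight L \<psi>)"
  by (simp add: inner_product_def weight_def of_real_cmod_power2 ac_simps)

lemma weight_nonneg: "weight L \<psi> \<ge> 0"
  by (simp add: weight_def sum_nonneg)

text \<open>The termwise inequality \<open>2 * x * y \<le> x\<^sup>2 + y\<^sup>2\<close> takes the
  place of Cauchy-Schwarz; it is as good here, since later both weights are at most that of the same
  vector.\<close>

lemma norm_inner_product_le: "2 * cmod (inner_product L \<phi> \<psi>) \<le> weight L \<phi> + weight L \<psi>"
proof -
  have "cmod (inner_product L \<phi> \<psi>) \<le> (\<Sum>x\<in>configs L. cmod (\<phi> x) * cmod (\<psi> x))"
    unfolding inner_product_def by (rule sum_norm_le) (simp add: norm_mult)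
  moreover have "2 * (\<Sum>x\<in>configs L. cmod (\<phi> x) * cmod (\<psi> x)) \<le> weight L \<phi> + weight L \<psi>"
    unfolding weight_def sum_distrib_left sum.distrib[symmetric]
  proof (intro sum_mono)
    fix x
    show "2 * (cmod (\<phi> x) * cmod (\<psi> x)) \<le> (cmod (\<phi> x))\<^sup>2 + (cmod (\<psi> x))\<^sup>2"
      using sum_squares_bound[of "cmod (\<phi> x)" "cmod (\<psi> x)"] by simp
  qed
  ultimately show ?thesis by linarith
qed

section \<open>Sums over configurations and adjoints\<close>

lemma finite_configs: "finite (sites L) \<Longrightarrow> finite (configs L :: (nat \<Rightarrow> 'd::finite) set)"
  by (simp add: configs_def finite_PiE)

lemma configs_upd: "v \<in> sites L \<Longrightarrow> x \<in> configs L \<Longrightarrow> x(v := j) \<in> configs L"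
  by (auto simp: configs_def PiE_iff extensional_def)

text \<open>Exchanging the value at \<open>v\<close> with the second summation index is an
  involution. This is what moves a one-site operator across an inner product.\<close>

lemma sum_configs_swap:
  fixes f :: "(nat \<Rightarrow> 'd::finite) \<Rightarrow> 'd \<Rightarrow> 'b::comm_monoid_add"
  assumes v: "v \<in> sites L"
  shows "(\<Sum>x\<in>configs L. \<Sum>j\<in>UNIV. f x j) = (\<Sum>x\<in>configs L. \<Sum>j\<in>UNIV. f (x(v := j)) (x v))"
  unfolding sum.cartesian_product
  by (rule sum.reindex_bij_witness[where i = "\<lambda>(x, j). (x(v := j), x v)"
        and j = "\<lambda>(x, j). (x(v := j), x v)"]) (auto simp: configs_upd[OF v])

lemma sum_configs_average:
  fixes f :: "(nat \<Rightarrow> 'd::finite) \<Rightarrow> 'b::comm_semiring_1"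
  assumes v: "v \<in> sites L"
  shows "(\<Sum>x\<in>configs L. \<Sum>j\<in>UNIV. f (x(v := j))) = of_nat CARD('d) * (\<Sum>x\<in>configs L. f x)"
  using sum_configs_swap[OF v, of "\<lambda>x j. f x"] by (simp add: sum_distrib_left)

lemma inner_product_site_op:
  assumes v: "v \<in> sites L"
  shows "inner_product L \<phi> (site_op v m \<psi>) = inner_product L (site_op v (\<lambda>p q. cnj (m q p)) \<phi>) \<psi>"
proof -
  have "inner_product L \<phi> (site_op v m \<psi>)
      = (\<Sum>x\<in>configs L. \<Sum>j\<in>UNIV. cnj (\<phi> x) * (m (x v) j * \<psi> (x(v := j))))"
    by (simp add: inner_product_def site_op_def sum_distrib_left)
  also have "\<dots> = (\<Sum>x\<in>configs L. \<Sum>j\<in>UNIV. cnj (\<phi> (x(v := j))) * (m j (x v) * \<psi> x))"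
    by (subst sum_configs_swap[OF v]) simp
  also have "\<dots> = inner_product L (site_op v (\<lambda>p q. cnj (m q p)) \<phi>) \<psi>"
    by (simp add: inner_product_def site_op_def sum_distrib_left sum_distrib_right ac_simps)
  finally show ?thesis .
qed

section \<open>Measurements and their branches\<close>

lemma inner_product_site_op_ketbra:
  assumes "v \<in> sites L"
  shows "inner_product L \<phi> (site_op v (ketbra u) \<psi>) = inner_product L (site_op v (ketbra u) \<phi>) \<psi>"
  using inner_product_site_op[OF assms, of \<phi> "ketbra u" \<psi>] by (simp add: ketbra_def mult.commute)

text \<open>The projection at \<open>b\<close> is self-adjoint, idempotent and commutes with
  \<open>T\<close>, so the cross terms between its range and the complement vanish. Expectations of
  operators away from \<open>b\<close> therefore add up over the two branches of a measurement at
  \<open>b\<close>.\<close>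

lemma inner_product_projection_split:
  fixes \<psi> :: "(nat \<Rightarrow> 'd::finite) \<Rightarrow> complex"
  assumes b: "b \<in> sites L" and u: "(\<Sum>j\<in>UNIV. (cmod (u j))\<^sup>2) = 1"
    and lin: "\<And>\<phi> \<theta>. T (\<lambda>x. \<phi> x - \<theta> x) = (\<lambda>x. T \<phi> x - T \<theta> x)"
    and comm: "\<And>\<phi>. T (site_op b (ketbra u) \<phi>) = site_op b (ketbra u) (T \<phi>)"
  defines "\<psi>P \<equiv> site_op b (ketbra u) \<psi>"
  shows "inner_product L \<psi>P (T \<psi>P) = inner_product L \<psi> (T \<psi>P)"
    and "inner_product L (\<lambda>x. \<psi> x - \<psi>P x) (T (\<lambda>x. \<psi> x - \<psi>P x))
      = inner_product L \<psi> (T \<psi>) - inner_product L \<psi>P (T \<psi>P)"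
proof -
  show 1: "inner_product L \<psi>P (T \<psi>P) = inner_product L \<psi> (T \<psi>P)"
    unfolding \<psi>P_def
    by (simp add: inner_product_site_op_ketbra[OF b, symmetric] comm site_op_ketbra_idem[OF u])
  have "inner_product L \<psi>P (T \<psi>) = inner_product L \<psi> (T \<psi>P)"
    unfolding \<psi>P_def by (simp add: inner_product_site_op_ketbra[OF b, symmetric] comm)
  with 1 show "inner_product L (\<lambda>x. \<psi> x - \<psi>P x) (T (\<lambda>x. \<psi> x - \<psi>P x))
      = inner_product L \<psi> (T \<psi>) - inner_product L \<psi>P (T \<psi>P)"
    by (simp add: lin inner_product_diff_left inner_product_diff_right)
qed

lemma weight_projection_split:
  fixes \<psi> :: "(nat \<Rightarrow> 'd::finite) \<Rightarrow> complex"
  assumes "b \<in> sites L" and "(\<Sum>j\<in>UNIV. (cmod (u j))\<^sup>2) = 1"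
  defines "\<psi>P \<equiv> site_op b (ketbra u) \<psi>"
  shows "complex_of_real (weight L \<psi>P) = inner_product L \<psi> \<psi>P"
    and "weight L (\<lambda>x. \<psi> x - \<psi>P x) = weight L \<psi> - weight L \<psi>P"
proof -
  note s = inner_product_projection_split[OF assms(1,2), of "\<lambda>\<psi>. \<psi>" \<psi>, folded \<psi>P_def]
  show "complex_of_real (weight L \<psi>P) = inner_product L \<psi> \<psi>P"
    using s(1) by (simp add: inner_product_self)
  have "complex_of_real (weight L (\<lambda>x. \<psi> x - \<psi>P x)) = complex_of_real (weight L \<psi> - weight L \<psi>P)"
    using s(2) by (simp add: inner_product_self)
  then show "weight L (\<lambda>x. \<psi> x - \<psi>P x) = weight L \<psi> - weight L \<psi>P"
    using of_real_eq_iff by blast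
qed

text \<open>The matrix unit copies the slice \<open>x v = j\<close> of \<psi> onto the slice
  \<open>x v = i\<close> and erases the rest.\<close>

lemma weight_site_op_munit_le:
  assumes fin: "finite (sites L)" and v: "v \<in> sites L"
  shows "weight L (site_op v (munit i j) \<psi>) \<le> weight L \<psi>"
proof -
  have "weight L (site_op v (munit i j) \<psi>)
      = (\<Sum>x | x \<in> configs L \<and> x v = i. (cmod (\<psi> (x(v := j))))\<^sup>2)"
    unfolding weight_def using finite_configs[OF fin]
    by (intro sum.mono_neutral_cong_right) (auto simp: site_op_munit)
  also have "\<dots> = (\<Sum>x | x \<in> configs L \<and> x v = j. (cmod (\<psi> x))\<^sup>2)"
    by (rule sum.reindex_bij_witness[where i = "\<lambda>x. x(v := i)" and j = "\<lambda>x. x(v := j)"])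
      (auto simp: configs_upd[OF v])
  also have "\<dots> \<le> weight L \<psi>"
    unfolding weight_def using finite_configs[OF fin] by (intro sum_mono2) auto
  finally show ?thesis .
qed

lemma inner_product_site_op_munit_le:
  assumes "finite (sites L)" "v \<in> sites L"
  shows "cmod (inner_product L \<psi> (site_op v (munit i j) \<psi>)) \<le> weight L \<psi>"
  using norm_inner_product_le[of L \<psi> "site_op v (munit i j) \<psi>"]
    weight_site_op_munit_le[OF assms, of i j \<psi>] by linarith

lemma inner_product_site_op_munit2_le:
  assumes "finite (sites L)" "a \<in> sites L" "b \<in> sites L"
  shows "cmod (inner_product L \<psi> (site_op a (munit i i') (site_op b (munit j j') \<psi>))) \<le> weight L \<psi>"
  using norm_inner_product_le[of L \<psi> "site_op a (munit i i') (site_op b (munit j j') \<psi>)"]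
    weight_site_op_munit_le[OF assms(1,2), of i i' "site_op b (munit j j') \<psi>"]
    weight_site_op_munit_le[OF assms(1,3), of j j' \<psi>] by linarith

lemma inner_product_site_op_expand:
  fixes \<psi> :: "(nat \<Rightarrow> 'd::finite) \<Rightarrow> complex"
  shows "inner_product L \<phi> (site_op v m \<psi>)
      = (\<Sum>j\<in>UNIV. \<Sum>j'\<in>UNIV. m j j' * inner_product L \<phi> (site_op v (munit j j') \<psi>))"
proof -
  have *: "site_op v m \<psi> x = (\<Sum>j\<in>UNIV. \<Sum>j'\<in>UNIV. m j j' * site_op v (munit j j') \<psi> x)" for x
    unfolding site_op_munit
    by (subst sum.swap) (simp add: site_op_def if_distrib[of "\<lambda>z. _ * z"] cong: if_cong)
  have "inner_product L \<phi> (site_op v m \<psi>) = (\<Sum>x\<in>configs L. \<Sum>j\<in>UNIV. \<Sum>j'\<in>UNIV.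
      m j j' * (cnj (\<phi> x) * site_op v (munit j j') \<psi> x))"
    by (simp add: inner_product_def * sum_distrib_left mult.left_commute)
  also have "\<dots> = (\<Sum>j\<in>UNIV. \<Sum>j'\<in>UNIV. \<Sum>x\<in>configs L.
      m j j' * (cnj (\<phi> x) * site_op v (munit j j') \<psi> x))"
    by (subst sum.swap, rule sum.cong[OF refl], rule sum.swap)
  finally show ?thesis by (simp add: inner_product_def sum_distrib_left)
qed

section \<open>Reduced matrices\<close>

text \<open>The transpose of the usual partial trace, unnormalised. Its \<open>norm\<close> is the
  Frobenius norm, so the squared norm divided by \<open>weight L \<psi>\<close> is the purity at
  \<open>v\<close> times the weight.\<close>

definition reduced_matrix :: "lattice \<Rightarrow> nat \<Rightarrow> ((nat \<Rightarrow> 'd::finite) \<Rightarrow> complex) \<Rightarrow> complex ^ 'd ^ 'd" where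
  "reduced_matrix L v \<psi> = (\<chi> i i'. inner_product L \<psi> (site_op v (munit i i') \<psi>))"

lemma reduced_nth: "reduced_matrix L v \<psi> $ i $ i' = inner_product L \<psi> (site_op v (munit i i') \<psi>)"
  by (simp add: reduced_matrix_def)

lemma norm_le_sum_norm_nth: "norm x \<le> (\<Sum>i\<in>UNIV. norm (x $ i))"
  unfolding norm_vec_def by (rule L2_set_le_sum) simp

lemma norm_reduced_le:
  fixes \<psi> :: "(nat \<Rightarrow> 'd::finite) \<Rightarrow> complex"
  assumes "finite (sites L)" "v \<in> sites L"
  shows "norm (reduced_matrix L v \<psi>) \<le> (real CARD('d))\<^sup>2 * weight L \<psi>"
proof -
  have "norm (reduced_matrix L v \<psi>) \<le> (\<Sum>i\<in>UNIV. \<Sum>i'\<in>UNIV. cmod (reduced_matrix L v \<psi> $ i $ i'))"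
    by (rule order_trans[OF norm_le_sum_norm_nth]) (intro sum_mono norm_le_sum_norm_nth)
  also have "\<dots> \<le> (\<Sum>i\<in>(UNIV::'d set). \<Sum>i'\<in>(UNIV::'d set). weight L \<psi>)"
    unfolding reduced_nth by (intro sum_mono inner_product_site_op_munit_le assms)
  finally show ?thesis by (simp add: power2_eq_square)
qed

section \<open>Convexity and polarization estimates\<close>

text \<open>Convexity of squared norm over weight, with an explicit gain. With \<open>X\<close> and
  \<open>Y\<close> the reduced matrices of two measurement branches, it tells how much the purity
  grows.\<close>

lemma norm_power2_div_increment:
  fixes X Y :: "'a::real_inner"
  assumes "0 \<le> x" "0 \<le> y" and X: "norm X \<le> C * x" and Y: "norm Y \<le> C * y"
  shows "(norm (X + Y))\<^sup>2 / (x + y) + (norm (X - (x / (x + y)) *\<^sub>R (X + Y)))\<^sup>2 / (x + y)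
    \<le> (norm X)\<^sup>2 / x + (norm Y)\<^sup>2 / y"
proof (cases "x = 0 \<or> y = 0")
  \<comment> \<open>The bounds by \<open>C\<close> force the vector of a branch of weight zero to
    vanish, which agrees with division by zero giving 0.\<close>
  case True
  then show ?thesis
  proof
    assume "x = 0"
    then show ?thesis using X by simp
  next
    assume "y = 0"
    then show ?thesis using Y by (cases "x = 0") simp_all
  qed
next
  case False
  then have x: "x > 0" and y: "y > 0" using assms by auto
  \<comment> \<open>The exact gain is \<open>(norm Z)\<^sup>2 / (x * y * (x + y))\<close>. Replacing
    \<open>x * y\<close> by the larger \<open>(x + y)\<^sup>2\<close> leaves the part that is
    claimed.\<close>
  define Z where "Z = y *\<^sub>R X - x *\<^sub>R Y"
  have "X - (x / (x + y)) *\<^sub>R (X + Y) = (1 / (x + y)) *\<^sub>R Z"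
  proof -
    have "X = (x / (x + y) + y / (x + y)) *\<^sub>R X"
      using x y by (simp flip: add_divide_distrib)
    then have "X - (x / (x + y)) *\<^sub>R (X + Y)
        = (x / (x + y) + y / (x + y)) *\<^sub>R X - (x / (x + y)) *\<^sub>R (X + Y)" by simp
    then show ?thesis by (simp add: Z_def algebra_simps)
  qed
  then have "(norm (X - (x / (x + y)) *\<^sub>R (X + Y)))\<^sup>2 / (x + y) = (norm Z)\<^sup>2 / ((x + y)\<^sup>2 * (x + y))"
    using x y by (simp add: power_divide)
  also have "\<dots> \<le> (norm Z)\<^sup>2 / ((x * y) * (x + y))"
  proof (rule divide_left_mono)
    show "x * y * (x + y) \<le> (x + y)\<^sup>2 * (x + y)"
      using x y by (intro mult_right_mono) (auto simp: power2_eq_square algebra_simps)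
  qed (use x y in auto)
  also have "\<dots> = (norm X)\<^sup>2 / x + (norm Y)\<^sup>2 / y - (norm (X + Y))\<^sup>2 / (x + y)"
  proof -
    have Z: "(norm Z)\<^sup>2 = y\<^sup>2 * (norm X)\<^sup>2 - 2 * x * y * (X \<bullet> Y) + x\<^sup>2 * (norm Y)\<^sup>2"
      unfolding Z_def power2_norm_eq_inner
      by (simp add: inner_diff_left inner_diff_right inner_commute power2_eq_square algebra_simps)
    have XY: "(norm (X + Y))\<^sup>2 = (norm X)\<^sup>2 + 2 * (X \<bullet> Y) + (norm Y)\<^sup>2"
      unfolding power2_norm_eq_inner
      by (simp add: inner_add_left inner_add_right inner_commute)
    show ?thesis unfolding Z XY using x y by (simp add: field_simps power2_eq_square)
  qed
  finally show ?thesis by simp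
qed

text \<open>The measurement argument controls correlations only with rank-one projections;
  polarization extends this control to all matrix units.\<close>

lemma polarization_bound:
  fixes c :: "'d::finite \<Rightarrow> 'd \<Rightarrow> complex"
  assumes unit: "\<And>u. (\<Sum>j\<in>UNIV. (cmod (u j))\<^sup>2) = 1 \<Longrightarrow>
      cmod (\<Sum>j\<in>UNIV. \<Sum>j'\<in>UNIV. ketbra u j j' * c j j') \<le> s"
  shows "cmod (c k l) \<le> 2 * s"
proof (cases "k = l")
  case True
  let ?u = "\<lambda>j. if j = k then 1 else 0"
  have "(\<Sum>j\<in>UNIV. (cmod (?u j))\<^sup>2) = 1" by (simp add: if_distrib[of cmod] if_distrib[of "\<lambda>z. z\<^sup>2"] cong: if_cong)
  from unit[OF this] have "cmod (c k k) \<le> s"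
    by (simp add: ketbra_def if_distrib[of cnj] if_distrib[of "\<lambda>z. z * _"] if_distrib[of "\<lambda>z. _ * z"] cong: if_cong)
  moreover have "0 \<le> cmod (c k k)" by simp
  ultimately have "cmod (c k k) \<le> 2 * s" by linarith
  then show ?thesis using True by simp
next
  case False
  define r where "r = complex_of_real (1 / sqrt 2)"
  have rr: "r * cnj r = 1 / 2" "cnj r = r" by (auto simp: r_def complex_eq_iff)
  \<comment> \<open>The unit vectors \<open>(e_k + w e_l) / sqrt 2\<close>, to be used for the four
    fourth roots of unity \<open>w\<close>.\<close>
  define u where "u w j = (if j = k then r else if j = l then w * r else 0)" for w j
  have two: "(\<Sum>j\<in>UNIV. g j) = g k + g l" if "\<And>j. j \<noteq> k \<Longrightarrow> j \<noteq> l \<Longrightarrow> g j = 0"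
    for g :: "'d \<Rightarrow> complex"
  proof -
    have "(\<Sum>j\<in>UNIV. g j) = (\<Sum>j\<in>{k, l}. g j)"
      using that by (intro sum.mono_neutral_right) auto
    then show ?thesis using False by simp
  qed
  have w: "cmod (c k k + c l l + cnj w * c k l + w * c l k) \<le> 2 * s" if "cmod w = 1" for w
  proof -
    have ww: "w * cnj w = 1" using that of_real_cmod_power2[of w] by simp
    have "complex_of_real (\<Sum>j\<in>UNIV. (cmod (u w j))\<^sup>2) = (\<Sum>j\<in>UNIV. u w j * cnj (u w j))"
      by (simp add: of_real_cmod_power2)
    also have "\<dots> = r * cnj r + (w * cnj w) * (r * cnj r)"
      using False by (subst two) (auto simp: u_def)
    also have "\<dots> = 1" by (simp add: ww rr(1))
    finally have "(\<Sum>j\<in>UNIV. (cmod (u w j))\<^sup>2) = 1"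
      using of_real_eq_1_iff by blast
    from unit[OF this]
    have "cmod (\<Sum>j\<in>UNIV. \<Sum>j'\<in>UNIV. ketbra (u w) j j' * c j j') \<le> s" .
    also have "(\<Sum>j\<in>UNIV. \<Sum>j'\<in>UNIV. ketbra (u w) j j' * c j j')
        = (\<Sum>j\<in>UNIV. ketbra (u w) j k * c j k + ketbra (u w) j l * c j l)"
      by (intro sum.cong two) (auto simp: u_def ketbra_def)
    also have "\<dots> = (r * cnj r) * (c k k + (w * cnj w) * c l l + cnj w * c k l + w * c l k)"
      using False by (subst two) (auto simp: u_def ketbra_def algebra_simps)
    finally show ?thesis by (simp add: ww rr(1) norm_mult norm_divide)
  qed
  have tri: "cmod (z1 - z2 + \<i> * z3 - \<i> * z4) \<le> cmod z1 + cmod z2 + cmod z3 + cmod z4" for z1 z2 z3 z4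
    using norm_triangle_ineq4[of "z1 - z2 + \<i> * z3" "\<i> * z4"] norm_triangle_ineq[of "z1 - z2" "\<i> * z3"]
      norm_triangle_ineq4[of z1 z2] unfolding norm_mult norm_ii by linarith
  have n: "cmod 1 = 1" "cmod (- 1) = 1" "cmod \<i> = 1" "cmod (- \<i>) = 1" by simp_all
  \<comment> \<open>Multiplying the value at \<open>w\<close> by \<open>w\<close> and summing over
    the four roots cancels everything except the coefficient of \<open>cnj w\<close>.\<close>
  have 4: "4 * c k l = (c k k + c l l + cnj 1 * c k l + 1 * c l k)
      - (c k k + c l l + cnj (- 1) * c k l + (- 1) * c l k)
      + \<i> * (c k k + c l l + cnj \<i> * c k l + \<i> * c l k)
      - \<i> * (c k k + c l l + cnj (- \<i>) * c k l + (- \<i>) * c l k)"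
    by (simp add: algebra_simps)
  have "cmod (4 * c k l) \<le> cmod (c k k + c l l + cnj 1 * c k l + 1 * c l k)
      + cmod (c k k + c l l + cnj (- 1) * c k l + (- 1) * c l k)
      + cmod (c k k + c l l + cnj \<i> * c k l + \<i> * c l k)
      + cmod (c k k + c l l + cnj (- \<i>) * c k l + (- \<i>) * c l k)"
    unfolding 4 by (rule tri)
  also have "\<dots> \<le> 2 * s + 2 * s + 2 * s + 2 * s"
    by (rule add_mono[OF add_mono[OF add_mono[OF w[OF n(1)] w[OF n(2)]] w[OF n(3)]] w[OF n(4)]])
  finally show ?thesis by (simp add: norm_mult)
qed

section \<open>Energy of a pair of spins\<close>

text \<open>The expectation of \<open>coupling h L a b\<close> in \<psi>, expanded in matrix units.
  The tuple lists row and column index at \<open>a\<close>, then row and column index at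
  \<open>b\<close>.\<close>

definition pair_energy ::
    "complex ^ ('d::finite \<times> 'd) ^ ('d \<times> 'd) \<Rightarrow> lattice \<Rightarrow> nat \<Rightarrow> nat \<Rightarrow> ((nat \<Rightarrow> 'd) \<Rightarrow> complex) \<Rightarrow> complex" where
  "pair_energy h L a b \<psi> = (\<Sum>(i, i', j, j')\<in>UNIV.
     h $ (i, j) $ (i', j') * inner_product L \<psi> (site_op a (munit i i') (site_op b (munit j j') \<psi>)))"

text \<open>The arguments are functions, not necessarily normalised, so that one-site slices of a
  global vector can be inserted directly.\<close>

definition product_pair_energy ::
    "complex ^ ('d::finite \<times> 'd) ^ ('d \<times> 'd) \<Rightarrow> ('d \<Rightarrow> complex) \<Rightarrow> ('d \<Rightarrow> complex) \<Rightarrow> complex" where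
  "product_pair_energy h \<phi> \<theta> = (\<Sum>(i, i', j, j')\<in>UNIV.
     h $ (i, j) $ (i', j') * ((cnj (\<phi> i) * \<phi> i') * (cnj (\<theta> j) * \<theta> j')))"

lemma norm_quad_sum_le:
  fixes f :: "'d::finite \<times> 'd \<times> 'd \<times> 'd \<Rightarrow> complex"
  assumes "\<And>p q. cmod (h $ p $ q) \<le> M" "\<And>q. cmod (f q) \<le> B" "0 \<le> M"
  shows "cmod (\<Sum>(i, i', j, j')\<in>UNIV. h $ (i, j) $ (i', j') * f (i, i', j, j'))
    \<le> M * real CARD('d) ^ 4 * B"
proof -
  have "cmod (\<Sum>(i, i', j, j')\<in>UNIV. h $ (i, j) $ (i', j') * f (i, i', j, j'))
      \<le> (\<Sum>q\<in>(UNIV::('d \<times> 'd \<times> 'd \<times> 'd) set). M * B)"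
    using assms by (intro sum_norm_le) (auto simp: norm_mult intro!: mult_mono)
  also have "\<dots> = M * real CARD('d) ^ 4 * B"
    by (simp add: card_prod power4_eq_xxxx)
  finally show ?thesis .
qed

lemma norm_pair_energy_le:
  fixes h :: "complex ^ ('d::finite \<times> 'd) ^ ('d \<times> 'd)"
  assumes "finite (sites L)" "a \<in> sites L" "b \<in> sites L"
    and "\<And>p q. cmod (h $ p $ q) \<le> M" "0 \<le> M"
  shows "cmod (pair_energy h L a b \<psi>) \<le> M * real CARD('d) ^ 4 * weight L \<psi>"
proof -
  let ?f = "\<lambda>(i, i', j, j'). inner_product L \<psi> (site_op a (munit i i') (site_op b (munit j j') \<psi>))"
  have "cmod (?f q) \<le> weight L \<psi>" for q
    by (cases q) (simp add: inner_product_site_op_munit2_le[OF assms(1-3)])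
  from norm_quad_sum_le[of h M ?f, OF assms(4) this assms(5)] show ?thesis
    by (simp add: pair_energy_def)
qed

text \<open>This exhibits reduced matrices as positive combinations of pure states, so that lower bounds
  on the energy of product vectors carry over to products of reduced matrices.\<close>

lemma reduced_average:
  fixes \<psi> :: "(nat \<Rightarrow> 'd::finite) \<Rightarrow> complex"
  assumes v: "v \<in> sites L"
  shows "of_nat CARD('d) * inner_product L \<psi> (site_op v (munit i i') \<psi>)
    = (\<Sum>x\<in>configs L. cnj (\<psi> (x(v := i))) * \<psi> (x(v := i')))"
  unfolding inner_product_def
  by (subst sum_configs_average[OF v, symmetric])
    (simp add: site_op_munit if_distrib[of "\<lambda>z. _ * z"] cong: if_cong)

lemma sum_product_scaled:
  fixes c :: "'a::comm_semiring_0"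
  shows "c * (sum f A * sum g B) = (\<Sum>x\<in>A. \<Sum>y\<in>B. c * (f x * g y))"
  by (subst sum_product) (simp add: sum_distrib_left)

lemma sum_swap3: "(\<Sum>x\<in>X. \<Sum>y\<in>Y. \<Sum>z\<in>Z. f x y z) = (\<Sum>z\<in>Z. \<Sum>x\<in>X. \<Sum>y\<in>Y. f x y z)"
proof -
  have "(\<Sum>x\<in>X. \<Sum>y\<in>Y. \<Sum>z\<in>Z. f x y z) = (\<Sum>x\<in>X. \<Sum>z\<in>Z. \<Sum>y\<in>Y. f x y z)"
    by (intro sum.cong refl sum.swap)
  also have "\<dots> = (\<Sum>z\<in>Z. \<Sum>x\<in>X. \<Sum>y\<in>Y. f x y z)"
    by (rule sum.swap)
  finally show ?thesis .
qed

text \<open>The two reduced matrices are averages of pure states over independent configurations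
  \<open>x\<close> and \<open>y\<close>. Summing the bound \<open>e\<close> over all pairs of
  slices, one at \<open>a\<close> from \<open>x\<close> and one at \<open>b\<close> from
  \<open>y\<close>, gives the claim.\<close>

lemma reduced_product_energy_ge:
  fixes h :: "complex ^ ('d::finite \<times> 'd) ^ ('d \<times> 'd)"
  assumes fin: "finite (sites L)" and a: "a \<in> sites L" and b: "b \<in> sites L"
    and e: "\<And>\<phi> \<theta>. e * ((\<Sum>i\<in>UNIV. (cmod (\<phi> i))\<^sup>2) * (\<Sum>i\<in>UNIV. (cmod (\<theta> i))\<^sup>2))
      \<le> Re (product_pair_energy h \<phi> \<theta>)"
  shows "e * (weight L \<psi>)\<^sup>2 \<le> Re (\<Sum>(i, i', j, j')\<in>UNIV. h $ (i, j) $ (i', j') *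
    (inner_product L \<psi> (site_op a (munit i i') \<psi>) * inner_product L \<psi> (site_op b (munit j j') \<psi>)))"
    (is "_ \<le> Re ?S")
proof -
  define d where "d = real CARD('d)"
  have d: "d > 0" by (simp add: d_def)
  let ?w = "\<lambda>v x. (\<Sum>i\<in>UNIV. (cmod (\<psi> (x(v := i))))\<^sup>2)"
  have W: "d * weight L \<psi> = (\<Sum>x\<in>configs L. ?w v x)" if "v \<in> sites L" for v
    unfolding weight_def d_def using sum_configs_average[OF that, of "\<lambda>x. (cmod (\<psi> x))\<^sup>2"] by simp
  have "d\<^sup>2 * (e * (weight L \<psi>)\<^sup>2) = e * ((d * weight L \<psi>) * (d * weight L \<psi>))"
    by (simp add: power2_eq_square)
  also have "\<dots> = (\<Sum>x\<in>configs L. \<Sum>y\<in>configs L. e * (?w a x * ?w b y))"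
  proof -
    note sum_product_scaled[of e "?w a" "configs L" "?w b" "configs L"]
    then show ?thesis unfolding W[OF a, symmetric] W[OF b, symmetric] .
  qed
  also have "\<dots> \<le> (\<Sum>x\<in>configs L. \<Sum>y\<in>configs L.
      Re (product_pair_energy h (\<lambda>i. \<psi> (x(a := i))) (\<lambda>i. \<psi> (y(b := i)))))"
    by (intro sum_mono e)
  also have "\<dots> = Re (\<Sum>x\<in>configs L. \<Sum>y\<in>configs L.
      product_pair_energy h (\<lambda>i. \<psi> (x(a := i))) (\<lambda>i. \<psi> (y(b := i))))"
    by simp
  also have "(\<Sum>x\<in>configs L. \<Sum>y\<in>configs L.
      product_pair_energy h (\<lambda>i. \<psi> (x(a := i))) (\<lambda>i. \<psi> (y(b := i)))) =
    (\<Sum>q\<in>UNIV. \<Sum>x\<in>configs L. \<Sum>y\<in>configs L. case q of (i, i', j, j') \<Rightarrow>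
      h $ (i, j) $ (i', j') * ((cnj (\<psi> (x(a := i))) * \<psi> (x(a := i'))) * (cnj (\<psi> (y(b := j))) * \<psi> (y(b := j')))))"
    unfolding product_pair_energy_def
    by (rule sum_swap3)
  also have "\<dots> = (\<Sum>(i, i', j, j')\<in>UNIV. h $ (i, j) $ (i', j') *
    ((of_nat CARD('d) * inner_product L \<psi> (site_op a (munit i i') \<psi>)) *
     (of_nat CARD('d) * inner_product L \<psi> (site_op b (munit j j') \<psi>))))"
    unfolding reduced_average[OF a] reduced_average[OF b]
    by (intro sum.cong) (auto simp: sum_product_scaled)
  also have "\<dots> = complex_of_real (d\<^sup>2) * ?S"
    by (auto simp: sum_distrib_left d_def power2_eq_square intro!: sum.cong)
  finally have "d\<^sup>2 * (e * (weight L \<psi>)\<^sup>2) \<le> Re (complex_of_real (d\<^sup>2) * ?S)" .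
  moreover have "Re (complex_of_real r * z) = r * Re z" for r z by simp
  ultimately have "d\<^sup>2 * (e * (weight L \<psi>)\<^sup>2) \<le> d\<^sup>2 * Re ?S" by (simp only:)
  moreover have "0 < d\<^sup>2" using d by simp
  ultimately show ?thesis by (simp only: mult_le_cancel_left_pos)
qed

text \<open>The pair energy splits into that of the product of the reduced matrices, which is at
  least \<open>e * weight L \<psi>\<close>, and a covariance term. If no projection at
  \<open>b\<close> disturbs the normalised state of \<open>a\<close> much, polarization makes every
  covariance small.\<close>

lemma pair_energy_ge_of_weak_correlation:
  fixes h :: "complex ^ ('d::finite \<times> 'd) ^ ('d \<times> 'd)"
  assumes fin: "finite (sites L)" and a: "a \<in> sites L" and b: "b \<in> sites L" and ab: "a \<noteq> b"
    and M: "\<And>p q. cmod (h $ p $ q) \<le> M" "0 \<le> M"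
    and e: "\<And>\<phi> \<theta>. e * ((\<Sum>i\<in>UNIV. (cmod (\<phi> i))\<^sup>2) * (\<Sum>i\<in>UNIV. (cmod (\<theta> i))\<^sup>2))
      \<le> Re (product_pair_energy h \<phi> \<theta>)"
    and small: "\<And>u. (\<Sum>j\<in>UNIV. (cmod (u j))\<^sup>2) = 1 \<Longrightarrow>
      norm (reduced_matrix L a (site_op b (ketbra u) \<psi>)
        - (weight L (site_op b (ketbra u) \<psi>) / weight L \<psi>) *\<^sub>R reduced_matrix L a \<psi>) \<le> s"
  shows "e * weight L \<psi> - M * real CARD('d) ^ 4 * (2 * s) \<le> Re (pair_energy h L a b \<psi>)"
proof -
  define p where "p = weight L \<psi>"
  define A where "A i i' = inner_product L \<psi> (site_op a (munit i i') \<psi>)" for i i'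
  define B where "B j j' = inner_product L \<psi> (site_op b (munit j j') \<psi>)" for j j'
  define G where "G i i' j j' = inner_product L \<psi> (site_op a (munit i i') (site_op b (munit j j') \<psi>))" for i i' j j'
  \<comment> \<open>The unnormalised covariance of the matrix units at \<open>a\<close> and
    \<open>b\<close>.\<close>
  define c where "c i i' j j' = G i i' j j' - A i i' * B j j' / p" for i i' j j'
  have c: "cmod (c i i' j j') \<le> 2 * s" for i i' j j'
  proof (rule polarization_bound)
    fix u :: "'d \<Rightarrow> complex" assume u: "(\<Sum>j\<in>UNIV. (cmod (u j))\<^sup>2) = 1"
    let ?P = "site_op b (ketbra u) \<psi>"
    have "inner_product L ?P (site_op a (munit i i') ?P) = inner_product L \<psi> (site_op a (munit i i') ?P)"
      by (rule inner_product_projection_split(1)[OF b u])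
        (simp_all add: site_op_diff site_op_commute[OF ab])
    also have "\<dots> = (\<Sum>j\<in>UNIV. \<Sum>j'\<in>UNIV. ketbra u j j' * G i i' j j')"
      unfolding G_def site_op_commute[OF ab] by (rule inner_product_site_op_expand)
    finally have 1: "reduced_matrix L a ?P $ i $ i' = (\<Sum>j\<in>UNIV. \<Sum>j'\<in>UNIV. ketbra u j j' * G i i' j j')"
      by (simp add: reduced_nth)
    have 2: "complex_of_real (weight L ?P) = (\<Sum>j\<in>UNIV. \<Sum>j'\<in>UNIV. ketbra u j j' * B j j')"
      unfolding weight_projection_split(1)[OF b u] B_def by (rule inner_product_site_op_expand)
    let ?D = "reduced_matrix L a ?P - (weight L ?P / p) *\<^sub>R reduced_matrix L a \<psi>"
    \<comment> \<open>Contracting the covariance with the projection onto \<open>u\<close> yields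
      one entry of the change of the reduced matrix at \<open>a\<close>, which \<open>small\<close>
      bounds.\<close>
    have "(\<Sum>j\<in>UNIV. \<Sum>j'\<in>UNIV. ketbra u j j' * c i i' j j')
        = (\<Sum>j\<in>UNIV. \<Sum>j'\<in>UNIV. ketbra u j j' * G i i' j j')
          - (\<Sum>j\<in>UNIV. \<Sum>j'\<in>UNIV. ketbra u j j' * B j j') * A i i' / p"
      by (simp add: c_def right_diff_distrib sum_subtractf sum_divide_distrib sum_distrib_left sum_distrib_right ac_simps)
    also have "\<dots> = ?D $ i $ i'"
      unfolding 1[symmetric] 2[symmetric] by (simp only: vector_minus_component vector_scaleR_component) (simp add: A_def reduced_nth scaleR_conv_of_real)
    finally have "cmod (\<Sum>j\<in>UNIV. \<Sum>j'\<in>UNIV. ketbra u j j' * c i i' j j') = norm (?D $ i $ i')" by simp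
    also have "\<dots> \<le> norm ?D" by (rule order_trans[OF Finite_Cartesian_Product.norm_nth_le Finite_Cartesian_Product.norm_nth_le])
    also have "\<dots> \<le> s" using small[OF u] by (simp add: p_def)
    finally show "cmod (\<Sum>j\<in>UNIV. \<Sum>j'\<in>UNIV. ketbra u j j' * c i i' j j') \<le> s" .
  qed
  let ?S = "\<Sum>(i, i', j, j')\<in>UNIV. h $ (i, j) $ (i', j') * (A i i' * B j j')"
  let ?C = "\<Sum>(i, i', j, j')\<in>UNIV. h $ (i, j) $ (i', j') * c i i' j j'"
  have "pair_energy h L a b \<psi> = ?C + ?S / p"
    unfolding pair_energy_def sum_divide_distrib sum.distrib[symmetric]
    by (intro sum.cong) (auto simp: c_def G_def algebra_simps)
  then have "Re (pair_energy h L a b \<psi>) = Re ?C + Re ?S / p" by simp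
  moreover have "cmod ?C \<le> M * real CARD('d) ^ 4 * (2 * s)"
    using norm_quad_sum_le[of h M "\<lambda>(i, i', j, j'). c i i' j j'" "2 * s", OF M(1) _ M(2)] c by auto
  then have "- (M * real CARD('d) ^ 4 * (2 * s)) \<le> Re ?C"
    using abs_Re_le_cmod[of ?C] by linarith
  moreover have "e * p\<^sup>2 \<le> Re ?S"
    unfolding A_def B_def p_def by (rule reduced_product_energy_ge[OF fin a b e])
  \<comment> \<open>For \<open>p = 0\<close> both sides are 0, since division by zero gives
    0.\<close>
  then have "e * p \<le> Re ?S / p"
  proof (cases "p = 0")
    case False
    then have "p > 0" using weight_nonneg[of L \<psi>] by (simp add: p_def)
    with \<open>e * p\<^sup>2 \<le> Re ?S\<close> show ?thesis by (simp add: field_simps power2_eq_square)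
  qed simp
  ultimately show ?thesis unfolding p_def by linarith
qed

section \<open>Energy of a star\<close>

text \<open>A measurement at a third site \<open>c\<close> commutes with all operators at
  \<open>a\<close> and \<open>b\<close>, so no energy of this pair is lost by passing to the
  branches.\<close>

lemma pair_energy_projection_split:
  fixes \<psi> :: "(nat \<Rightarrow> 'd::finite) \<Rightarrow> complex"
  assumes c: "c \<in> sites L" and u: "(\<Sum>j\<in>UNIV. (cmod (u j))\<^sup>2) = 1" and "a \<noteq> c" "b \<noteq> c"
  defines "\<psi>P \<equiv> site_op c (ketbra u) \<psi>"
  shows "pair_energy h L a b \<psi> = pair_energy h L a b \<psi>P + pair_energy h L a b (\<lambda>x. \<psi> x - \<psi>P x)"
proof -
  have *: "inner_product L (\<lambda>x. \<psi> x - \<psi>P x) (site_op a m (site_op b n (\<lambda>x. \<psi> x - \<psi>P x)))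
      = inner_product L \<psi> (site_op a m (site_op b n \<psi>)) - inner_product L \<psi>P (site_op a m (site_op b n \<psi>P))" for m n
    unfolding \<psi>P_def
    by (rule inner_product_projection_split(2)[OF c u, where T = "\<lambda>\<psi>. site_op a m (site_op b n \<psi>)"])
      (simp_all add: site_op_diff site_op_commute[OF assms(3)] site_op_commute[OF assms(4)])
  show ?thesis
    unfolding pair_energy_def sum.distrib[symmetric] by (intro sum.cong) (auto simp: * algebra_simps)
qed

lemma reduced_projection_split:
  fixes \<psi> :: "(nat \<Rightarrow> 'd::finite) \<Rightarrow> complex"
  assumes c: "c \<in> sites L" and u: "(\<Sum>j\<in>UNIV. (cmod (u j))\<^sup>2) = 1" and "a \<noteq> c"
  defines "\<psi>P \<equiv> site_op c (ketbra u) \<psi>"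
  shows "reduced_matrix L a \<psi> = reduced_matrix L a \<psi>P + reduced_matrix L a (\<lambda>x. \<psi> x - \<psi>P x)"
proof -
  have "inner_product L (\<lambda>x. \<psi> x - \<psi>P x) (site_op a m (\<lambda>x. \<psi> x - \<psi>P x))
      = inner_product L \<psi> (site_op a m \<psi>) - inner_product L \<psi>P (site_op a m \<psi>P)" for m
    unfolding \<psi>P_def
    by (rule inner_product_projection_split(2)[OF c u, where T = "site_op a m"])
      (simp_all add: site_op_diff site_op_commute[OF assms(3)])
  then show ?thesis by (simp add: Finite_Cartesian_Product.vec_eq_iff reduced_nth)
qed

text \<open>The purity \<open>(norm (reduced_matrix L a \<psi>))\<^sup>2 / weight L \<psi>\<close> in the bound is the potential that pays
  for the leaves lost to measurements: splitting \<open>\<psi>\<close> by a measurement of a strongly correlated leaf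
  increases it by at least \<open>\<eta> * weight L \<psi>\<close>.\<close>

lemma star_energy_ge:
  fixes h :: "complex ^ ('d::finite \<times> 'd) ^ ('d \<times> 'd)"
  assumes fin: "finite (sites L)" and a: "a \<in> sites L"
    and M: "\<And>p q. cmod (h $ p $ q) \<le> M" "0 \<le> M"
    and e: "\<And>\<phi> \<theta>. e * ((\<Sum>i\<in>UNIV. (cmod (\<phi> i))\<^sup>2) * (\<Sum>i\<in>UNIV. (cmod (\<theta> i))\<^sup>2))
      \<le> Re (product_pair_energy h \<phi> \<theta>)"
    and eM: "e \<le> M * real CARD('d) ^ 4" and eta: "0 < \<eta>" and delta: "2 * M * real CARD('d) ^ 4 * sqrt \<eta> \<le> \<delta>"
    and S: "S \<subseteq> sites L - {a}"
  defines "D \<equiv> real CARD('d) ^ 4"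
  shows "(e - \<delta>) * card S * weight L \<psi>
      - (2 * M * D) / \<eta> * (D * weight L \<psi> - (norm (reduced_matrix L a \<psi>))\<^sup>2 / weight L \<psi>)
    \<le> (\<Sum>b\<in>S. Re (pair_energy h L a b \<psi>))"
  using S
proof (induction "card S" arbitrary: S \<psi> rule: less_induct)
  case less
  let ?Q = "\<lambda>\<psi>. (norm (reduced_matrix L a \<psi>))\<^sup>2 / weight L \<psi>"
  define p where "p = weight L \<psi>"
  have p: "p \<ge> 0" by (simp add: p_def weight_nonneg)
  have finS: "finite S" using less.prems fin finite_subset by blast
  have "0 \<le> sqrt \<eta>" using eta by simp
  then have "0 \<le> \<delta>" using M(2) delta by (smt (verit) mult_nonneg_nonneg zero_le_power of_nat_0_le_iff)
  have K: "0 \<le> (2 * M * D) / \<eta>" using M(2) eta by (simp add: D_def)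
  \<comment> \<open>The potential has a ceiling proportional to the weight; this is why only
    boundedly many measurements have to be paid for.\<close>
  have QD: "?Q \<psi> \<le> D * p"
  proof (cases "p = 0")
    case False
    have "(norm (reduced_matrix L a \<psi>))\<^sup>2 \<le> ((real CARD('d))\<^sup>2 * p)\<^sup>2"
      unfolding p_def by (intro power_mono norm_reduced_le fin a) simp
    then show ?thesis using False p
      by (simp add: D_def p_def field_simps power2_eq_square power4_eq_xxxx)
  qed (simp add: p_def)
  \<comment> \<open>Either some leaf is strongly correlated with the centre, with threshold
    \<open>\<eta> * p\<^sup>2\<close>, and is measured, or all leaves are weakly correlated and the
    pair bound applies to each.\<close>
  show ?case
  proof (cases "\<exists>b\<in>S. \<exists>u. (\<Sum>j\<in>UNIV. (cmod (u j))\<^sup>2) = 1 \<and>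
      \<eta> * p\<^sup>2 < (norm (reduced_matrix L a (site_op b (ketbra u) \<psi>)
        - (weight L (site_op b (ketbra u) \<psi>) / p) *\<^sub>R reduced_matrix L a \<psi>))\<^sup>2")
    case False
    have "(e - \<delta>) * p \<le> Re (pair_energy h L a b \<psi>)" if b: "b \<in> S" for b
    proof -
      \<comment> \<open>The negated threshold allows \<open>s = sqrt \<eta> * p\<close> in the pair
        bound; \<open>delta\<close> is the condition that turns the resulting error into at most
        \<open>\<delta> * p\<close>.\<close>
      have "e * weight L \<psi> - M * real CARD('d) ^ 4 * (2 * (sqrt \<eta> * p)) \<le> Re (pair_energy h L a b \<psi>)"
      proof (rule pair_energy_ge_of_weak_correlation[OF fin a _ _ M e])
        fix u :: "'d \<Rightarrow> complex" assume "(\<Sum>j\<in>UNIV. (cmod (u j))\<^sup>2) = 1"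
        with False b have "(norm (reduced_matrix L a (site_op b (ketbra u) \<psi>)
            - (weight L (site_op b (ketbra u) \<psi>) / p) *\<^sub>R reduced_matrix L a \<psi>))\<^sup>2 \<le> (sqrt \<eta> * p)\<^sup>2"
          using eta by (fastforce simp: power_mult_distrib not_less)
        then show "norm (reduced_matrix L a (site_op b (ketbra u) \<psi>)
            - (weight L (site_op b (ketbra u) \<psi>) / weight L \<psi>) *\<^sub>R reduced_matrix L a \<psi>) \<le> sqrt \<eta> * p"
          using eta p by (intro power2_le_imp_le[OF _ mult_nonneg_nonneg]) (auto simp: p_def)
      qed (use b less.prems in auto)
      moreover have "M * real CARD('d) ^ 4 * (2 * (sqrt \<eta> * p)) \<le> \<delta> * p"
        using mult_right_mono[OF delta p] by (simp add: ac_simps)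
      ultimately show ?thesis by (simp add: p_def algebra_simps)
    qed
    then have "(\<Sum>b\<in>S. (e - \<delta>) * p) \<le> (\<Sum>b\<in>S. Re (pair_energy h L a b \<psi>))" by (rule sum_mono)
    moreover have "0 \<le> (2 * M * D) / \<eta> * (D * p - ?Q \<psi>)"
      using K QD by (intro mult_nonneg_nonneg) auto
    ultimately show ?thesis by (simp add: p_def algebra_simps)
  next
    case True
    then obtain b u where b: "b \<in> S" and u: "(\<Sum>j\<in>UNIV. (cmod (u j))\<^sup>2) = 1"
      and big: "\<eta> * p\<^sup>2 < (norm (reduced_matrix L a (site_op b (ketbra u) \<psi>)
        - (weight L (site_op b (ketbra u) \<psi>) / p) *\<^sub>R reduced_matrix L a \<psi>))\<^sup>2" by blast
    have bL: "b \<in> sites L" "a \<noteq> b" using b less.prems by auto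
    define \<psi>P where "\<psi>P = site_op b (ketbra u) \<psi>"
    define \<psi>N where "\<psi>N = (\<lambda>x. \<psi> x - \<psi>P x)"
    have w: "weight L \<psi>P + weight L \<psi>N = p"
      using weight_projection_split(2)[OF bL(1) u, of \<psi>] by (simp add: \<psi>P_def \<psi>N_def p_def)
    have r: "reduced_matrix L a \<psi>P + reduced_matrix L a \<psi>N = reduced_matrix L a \<psi>"
      using reduced_projection_split[OF bL(1) u bL(2), of \<psi>] by (simp add: \<psi>P_def \<psi>N_def)
    have "?Q \<psi> + (norm (reduced_matrix L a \<psi>P - (weight L \<psi>P / p) *\<^sub>R reduced_matrix L a \<psi>))\<^sup>2 / p \<le> ?Q \<psi>P + ?Q \<psi>N"
      using norm_power2_div_increment[OF weight_nonneg weight_nonneg norm_reduced_le[OF fin a, of \<psi>P]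
          norm_reduced_le[OF fin a, of \<psi>N], unfolded w r]
      by (simp add: p_def)
    moreover have "\<eta> * p \<le> (norm (reduced_matrix L a \<psi>P - (weight L \<psi>P / p) *\<^sub>R reduced_matrix L a \<psi>))\<^sup>2 / p"
    proof (cases "p = 0")
      case False
      with p big show ?thesis by (simp add: \<psi>P_def field_simps power2_eq_square)
    qed simp
    ultimately have Q: "?Q \<psi> + \<eta> * p \<le> ?Q \<psi>P + ?Q \<psi>N" by linarith
    \<comment> \<open>The measured leaf is dropped. The induction hypothesis is then applied to both
      branches with the remaining leaves, which is why \<psi> had to be generalised.\<close>
    let ?T = "S - {b}"
    have T: "card ?T < card S" "?T \<subseteq> sites L - {a}" "real (card S) = real (card ?T) + 1"
      using b finS less.prems card_gt_0_iff[of S] by (auto simp: card_Diff_singleton)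
    have "(\<Sum>b'\<in>?T. Re (pair_energy h L a b' \<psi>))
        = (\<Sum>b'\<in>?T. Re (pair_energy h L a b' \<psi>P)) + (\<Sum>b'\<in>?T. Re (pair_energy h L a b' \<psi>N))"
      unfolding sum.distrib[symmetric] \<psi>P_def \<psi>N_def
      using pair_energy_projection_split[OF bL(1) u bL(2), of _ h \<psi>] by (intro sum.cong) auto
    moreover note less.hyps[OF T(1,2), of \<psi>P] less.hyps[OF T(1,2), of \<psi>N]
    moreover have "(e - \<delta>) * card ?T * weight L \<psi>P + (e - \<delta>) * card ?T * weight L \<psi>N = (e - \<delta>) * card ?T * p"
      unfolding w[symmetric] by (simp add: algebra_simps)
    moreover have "(2 * M * D) / \<eta> * (D * weight L \<psi>P - ?Q \<psi>P) + (2 * M * D) / \<eta> * (D * weight L \<psi>N - ?Q \<psi>N)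
        = (2 * M * D) / \<eta> * (D * p - (?Q \<psi>P + ?Q \<psi>N))"
      unfolding w[symmetric] by (simp add: algebra_simps)
    moreover have "(2 * M * D) / \<eta> * (D * p - (?Q \<psi>P + ?Q \<psi>N)) \<le> (2 * M * D) / \<eta> * (D * p - (?Q \<psi> + \<eta> * p))"
      using Q K by (intro mult_left_mono) auto
    \<comment> \<open>The purity gain is worth \<open>2 * M * D * p\<close>. One half compensates
      for the energy of the dropped leaf, which is at least \<open>- (M * D * p)\<close>; the other
      half covers its share \<open>(e - \<delta>) * p\<close> of the claimed bound.\<close>
    moreover have "(2 * M * D) / \<eta> * (D * p - (?Q \<psi> + \<eta> * p)) = (2 * M * D) / \<eta> * (D * p - ?Q \<psi>) - (2 * M * D) * p"
      using eta by (simp add: field_simps)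
    moreover have "- (M * D * p) \<le> Re (pair_energy h L a b \<psi>)"
      using norm_pair_energy_le[OF fin a bL(1) M, of \<psi>] abs_Re_le_cmod[of "pair_energy h L a b \<psi>"]
      by (simp add: D_def p_def)
    moreover have "(\<Sum>b'\<in>S. Re (pair_energy h L a b' \<psi>))
        = Re (pair_energy h L a b \<psi>) + (\<Sum>b'\<in>?T. Re (pair_energy h L a b' \<psi>))"
      by (rule sum.remove[OF finS b])
    moreover have "(e - \<delta>) * p \<le> M * D * p"
      unfolding D_def using eM \<open>0 \<le> \<delta>\<close> p by (intro mult_right_mono) auto
    moreover have "(e - \<delta>) * card S * p = (e - \<delta>) * card ?T * p + (e - \<delta>) * p"
      unfolding T(3) by (simp add: algebra_simps)
    ultimately show ?thesis
      unfolding p_def[symmetric] by (simp add: distrib_right)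
  qed
qed

section \<open>From pair energies to the Hamiltonian\<close>

text \<open>A row of \<open>coupling\<close> is supported on the configurations that agree with
  \<open>x\<close> away from \<open>a\<close> and \<open>b\<close>, and these are parametrised by
  their two values there.\<close>

lemma sum_coupling:
  fixes h :: "complex ^ ('d::finite \<times> 'd) ^ ('d \<times> 'd)"
  assumes fin: "finite (sites L)" and a: "a \<in> sites L" and b: "b \<in> sites L" and ab: "a \<noteq> b"
    and x: "x \<in> configs L"
  shows "(\<Sum>y\<in>configs L. coupling h L a b x y * \<psi> y)
    = (\<Sum>(i, i', j, j')\<in>UNIV. h $ (i, j) $ (i', j') * site_op a (munit i i') (site_op b (munit j j') \<psi>) x)"
proof -
  have "(\<Sum>y\<in>configs L. coupling h L a b x y * \<psi> y)
      = (\<Sum>y | y \<in> configs L \<and> (\<forall>v\<in>sites L - {a, b}. x v = y v). h $ (x a, x b) $ (y a, y b) * \<psi> y)"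
    using finite_configs[OF fin] by (intro sum.mono_neutral_cong_right) (auto simp: coupling_def)
  also have "\<dots> = (\<Sum>(i, i', j, j') | i = x a \<and> j = x b. h $ (i, j) $ (i', j') * \<psi> (x(a := i', b := j')))"
  proof (rule sum.reindex_bij_witness[where i = "\<lambda>(i, i', j, j'). x(a := i', b := j')"
        and j = "\<lambda>y. (x a, y a, x b, y b)"])
    fix y assume y: "y \<in> {y. y \<in> configs L \<and> (\<forall>v\<in>sites L - {a, b}. x v = y v)}"
    \<comment> \<open>Outside the lattice both sides agree because configurations are
      extensional.\<close>
    have *: "x(a := y a, b := y b) = y"
    proof
      fix v show "(x(a := y a, b := y b)) v = y v"
        using x y by (cases "v \<in> sites L") (auto simp: configs_def PiE_iff extensional_def)
    qed
    then show "(case (x a, y a, x b, y b) of (i, i', j, j') \<Rightarrow> x(a := i', b := j')) = y" by simp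
    show "(case (x a, y a, x b, y b) of (i, i', j, j') \<Rightarrow> h $ (i, j) $ (i', j') * \<psi> (x(a := i', b := j')))
        = h $ (x a, x b) $ (y a, y b) * \<psi> y" by (simp add: *)
  qed (use ab x a b in \<open>auto simp: configs_upd split: if_splits\<close>)
  also have "\<dots> = (\<Sum>(i, i', j, j')\<in>UNIV. h $ (i, j) $ (i', j') * site_op a (munit i i') (site_op b (munit j j') \<psi>) x)"
    using ab by (intro sum.mono_neutral_cong_left) (auto simp: site_op_munit split: if_splits)
  finally show ?thesis .
qed

definition bond_pairs :: "nat set \<Rightarrow> lattice \<Rightarrow> (nat \<times> nat) set" where
  "bond_pairs A L = {(a, b). {a, b} \<in> bonds L \<and> a \<in> A \<and> b \<notin> A}"

lemma bond_pairs_sites: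
  assumes "simple_graph L" "(a, b) \<in> bond_pairs A L"
  shows "a \<in> sites L" "b \<in> sites L" "a \<noteq> b"
  using assms by (auto simp: bond_pairs_def simple_graph_def)

lemma expectation_hamiltonian:
  fixes h :: "complex ^ ('d::finite \<times> 'd) ^ ('d \<times> 'd)"
  assumes fin: "finite (sites L)" and simple: "simple_graph L"
  shows "(\<Sum>x\<in>configs L. cnj (\<psi> x) * (\<Sum>y\<in>configs L. hamiltonian h A L x y * \<psi> y))
    = (\<Sum>(a, b)\<in>bond_pairs A L. pair_energy h L a b \<psi>)"
proof -
  have "(\<Sum>x\<in>configs L. cnj (\<psi> x) * (\<Sum>y\<in>configs L. hamiltonian h A L x y * \<psi> y))
      = (\<Sum>x\<in>configs L. \<Sum>y\<in>configs L. \<Sum>q\<in>bond_pairs A L. cnj (\<psi> x) * (coupling h L (fst q) (snd q) x y * \<psi> y))"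
    by (simp add: hamiltonian_def bond_pairs_def sum_distrib_left sum_distrib_right case_prod_unfold)
  also have "\<dots> = (\<Sum>q\<in>bond_pairs A L. \<Sum>x\<in>configs L. cnj (\<psi> x) * (\<Sum>y\<in>configs L. coupling h L (fst q) (snd q) x y * \<psi> y))"
    unfolding sum_distrib_left by (rule sum_swap3)
  also have "\<dots> = (\<Sum>q\<in>bond_pairs A L. pair_energy h L (fst q) (snd q) \<psi>)"
  proof (rule sum.cong[OF refl])
    fix q assume "q \<in> bond_pairs A L"
    then have q: "fst q \<in> sites L" "snd q \<in> sites L" "fst q \<noteq> snd q"
      using bond_pairs_sites[OF simple, of "fst q" "snd q"] by auto
    have "(\<Sum>x\<in>configs L. cnj (\<psi> x) * (\<Sum>y\<in>configs L. coupling h L (fst q) (snd q) x y * \<psi> y))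
      = (\<Sum>x\<in>configs L. \<Sum>(i, i', j, j')\<in>UNIV. h $ (i, j) $ (i', j') *
          (cnj (\<psi> x) * site_op (fst q) (munit i i') (site_op (snd q) (munit j j') \<psi>) x))"
      by (intro sum.cong) (auto simp: sum_coupling[OF fin q] sum_distrib_left mult.left_commute intro!: sum.cong)
    also have "\<dots> = pair_energy h L (fst q) (snd q) \<psi>"
      unfolding pair_energy_def inner_product_def
      by (subst sum.swap) (auto simp: sum_distrib_left intro!: sum.cong)
    finally show "(\<Sum>x\<in>configs L. cnj (\<psi> x) * (\<Sum>y\<in>configs L. coupling h L (fst q) (snd q) x y * \<psi> y))
      = pair_energy h L (fst q) (snd q) \<psi>" .
  qed
  finally show ?thesis by (simp add: case_prod_unfold)
qed

lemma hamiltonian_hermitian: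
  assumes "hermitian_matrix h"
  shows "hamiltonian h A L x y = cnj (hamiltonian h A L y x)"
proof -
  have *: "coupling h L a b x y = cnj (coupling h L a b y x)" for a b
  proof -
    have "(\<forall>v\<in>sites L - {a, b}. y v = x v) \<longleftrightarrow> (\<forall>v\<in>sites L - {a, b}. x v = y v)" by metis
    moreover have "h $ (x a, x b) $ (y a, y b) = cnj (h $ (y a, y b) $ (x a, x b))"
      using assms unfolding hermitian_matrix_def by blast
    ultimately show ?thesis
      unfolding coupling_def by (cases "\<forall>v\<in>sites L - {a, b}. x v = y v") auto
  qed
  show ?thesis
    unfolding hamiltonian_def cnj_sum case_prod_unfold by (intro sum.cong refl *)
qed

text \<open>At an eigenvector the quadratic form is the eigenvalue times the weight, so a lower
  bound on the form bounds every eigenvalue.\<close>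

lemma ground_energy_ge:
  fixes h :: "complex ^ ('d::finite \<times> 'd) ^ ('d \<times> 'd)"
  assumes fin: "finite (sites L)" and simple: "simple_graph L" and herm: "hermitian_matrix h"
    and bound: "\<And>\<psi>. c * weight L \<psi> \<le> Re (\<Sum>(a, b)\<in>bond_pairs A L. pair_energy h L a b \<psi>)"
  shows "c \<le> ground_energy L (hamiltonian h A L)"
  unfolding ground_energy_def
proof (rule cInf_greatest)
  \<comment> \<open>Nonemptiness of the spectrum is what allows a lower bound to pass to
    \<open>Inf\<close>.\<close>
  have "configs L \<noteq> ({} :: (nat \<Rightarrow> 'd) set)" by (simp add: configs_def PiE_eq_empty_iff)
  from hermitian_eigenvalue_exists[OF finite_configs[OF fin] this hamiltonian_hermitian[OF herm]]
  show "{E. is_energy_eigenvalue L (hamiltonian h A L) E} \<noteq> {}"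
    by (auto simp: is_energy_eigenvalue_def)
next
  fix E assume "E \<in> {E. is_energy_eigenvalue L (hamiltonian h A L) E}"
  then obtain \<psi> where nz: "\<exists>x\<in>configs L. \<psi> x \<noteq> 0"
    and eig: "\<And>x. x \<in> configs L \<Longrightarrow> (\<Sum>y\<in>configs L. hamiltonian h A L x y * \<psi> y) = complex_of_real E * \<psi> x"
    by (auto simp: is_energy_eigenvalue_def)
  have "(\<Sum>(a, b)\<in>bond_pairs A L. pair_energy h L a b \<psi>)
      = (\<Sum>x\<in>configs L. cnj (\<psi> x) * (complex_of_real E * \<psi> x))"
    unfolding expectation_hamiltonian[OF fin simple, symmetric] by (simp add: eig)
  also have "\<dots> = complex_of_real E * inner_product L \<psi> \<psi>"
    by (simp add: inner_product_def sum_distrib_left ac_simps)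
  finally have "c * weight L \<psi> \<le> E * weight L \<psi>"
    using bound[of \<psi>] by (simp add: inner_product_self)
  moreover have "weight L \<psi> \<noteq> 0"
    using nz finite_configs[OF fin] unfolding weight_def by (subst sum_nonneg_eq_0_iff) auto
  ultimately show "c \<le> E" using weight_nonneg[of L \<psi>] by simp
qed

section \<open>Product states as trial states\<close>

lemma sum_cmod_unit:
  fixes u :: "complex ^ 'd::finite"
  assumes "norm u = 1"
  shows "(\<Sum>i\<in>UNIV. (cmod (u $ i))\<^sup>2) = 1"
  using assms by (simp add: norm_vec_def L2_set_def)

lemma inner_product_product_vector:
  fixes \<phi> \<theta> :: "nat \<Rightarrow> complex ^ 'd::finite"
  assumes "finite (sites L)"
  shows "inner_product L (product_vector L \<phi>) (product_vector L \<theta>)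
    = (\<Prod>v\<in>sites L. \<Sum>i\<in>UNIV. cnj (\<phi> v $ i) * \<theta> v $ i)"
  unfolding inner_product_def product_vector_def configs_def
  by (subst prod_sum_PiE) (simp_all add: assms prod.distrib)

lemma site_op_munit_product_vector:
  assumes "finite (sites L)" and v: "v \<in> sites L"
  shows "site_op v (munit i i') (product_vector L \<phi>)
    = product_vector L (\<phi>(v := \<chi> p. if p = i then \<phi> v $ i' else 0))"
proof
  fix x :: "nat \<Rightarrow> 'a"
  have "(\<Prod>w\<in>sites L - {v}. \<phi> w $ (x(v := i')) w) = (\<Prod>w\<in>sites L - {v}. (\<phi>(v := \<chi> p. if p = i then \<phi> v $ i' else 0)) w $ x w)"
    by (intro prod.cong) auto
  then show "site_op v (munit i i') (product_vector L \<phi>) x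
      = product_vector L (\<phi>(v := \<chi> p. if p = i then \<phi> v $ i' else 0)) x"
    by (simp add: site_op_munit product_vector_def prod.remove[OF assms])
qed

text \<open>The inner product factorises over the sites, and every site other than \<open>a\<close>
  and \<open>b\<close> contributes its squared norm 1.\<close>

lemma pair_energy_product_vector:
  fixes h :: "complex ^ ('d::finite \<times> 'd) ^ ('d \<times> 'd)"
  assumes fin: "finite (sites L)" and a: "a \<in> sites L" and b: "b \<in> sites L" and ab: "a \<noteq> b"
    and unit: "\<And>v. v \<in> sites L \<Longrightarrow> norm (\<phi> v) = 1"
  shows "pair_energy h L a b (product_vector L \<phi>) = product_pair_energy h (\<lambda>i. \<phi> a $ i) (\<lambda>j. \<phi> b $ j)"
proof -
  have "inner_product L (product_vector L \<phi>) (site_op a (munit i i') (site_op b (munit j j') (product_vector L \<phi>)))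
      = (cnj (\<phi> a $ i) * \<phi> a $ i') * (cnj (\<phi> b $ j) * \<phi> b $ j')" for i i' j j'
  proof -
    define \<theta> where "\<theta> = \<phi>(b := \<chi> p. if p = j then \<phi> b $ j' else 0, a := \<chi> p. if p = i then \<phi> a $ i' else 0)"
    define f where "f v = (\<Sum>i\<in>UNIV. cnj (\<phi> v $ i) * \<theta> v $ i)" for v
    have "inner_product L (product_vector L \<phi>) (site_op a (munit i i') (site_op b (munit j j') (product_vector L \<phi>)))
        = (\<Prod>v\<in>sites L. f v)"
      using ab by (simp add: site_op_munit_product_vector[OF fin] a b inner_product_product_vector[OF fin] \<theta>_def f_def cong: if_cong)
    also have "\<dots> = (\<Prod>v\<in>{a, b}. f v)"
    proof (rule prod.mono_neutral_right[OF fin])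
      show "\<forall>v\<in>sites L - {a, b}. f v = 1"
      proof
        fix v assume v: "v \<in> sites L - {a, b}"
        have "f v = complex_of_real (\<Sum>i\<in>UNIV. (cmod (\<phi> v $ i))\<^sup>2)"
          using v by (simp add: f_def \<theta>_def of_real_cmod_power2 mult.commute)
        also have "\<dots> = 1" using v unit[of v] by (subst sum_cmod_unit) auto
        finally show "f v = 1" .
      qed
    qed (use a b in auto)
    also have "\<dots> = (cnj (\<phi> a $ i) * \<phi> a $ i') * (cnj (\<phi> b $ j) * \<phi> b $ j')"
      using ab by (simp add: f_def \<theta>_def if_distrib[of "\<lambda>z. _ * z"] cong: if_cong)
    finally show ?thesis .
  qed
  then show ?thesis by (simp add: pair_energy_def product_pair_energy_def)
qed

text \<open>The trial state puts \<open>u\<close> on \<open>A\<close> and \<open>w\<close>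
  elsewhere. Each oriented bond leads from \<open>A\<close> to its complement, so all bonds have the
  same energy.\<close>

lemma separable_energy_le_product:
  fixes h :: "complex ^ ('d::finite \<times> 'd) ^ ('d \<times> 'd)" and u w :: "complex ^ 'd"
  assumes fin: "finite (sites L)" and simple: "simple_graph L" and u: "norm u = 1" and w: "norm w = 1"
  shows "separable_energy L (hamiltonian h A L)
    \<le> real (card (bond_pairs A L)) * Re (product_pair_energy h (\<lambda>i. u $ i) (\<lambda>j. w $ j))"
proof -
  let ?H = "hamiltonian h A L"
  define \<phi> where "\<phi> v = (if v \<in> A then u else w)" for v
  define \<Phi> where "\<Phi> = product_vector L \<phi>"
  define \<rho> where "\<rho> x y = \<Phi> x * cnj (\<Phi> y)" for x y
  have \<phi>: "norm (\<phi> v) = 1" for v by (simp add: \<phi>_def u w)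
  have "separable L \<rho>"
    unfolding separable_def
    by (rule exI[of _ 1], rule exI[of _ "\<lambda>_. 1"], rule exI[of _ "\<lambda>_. \<phi>"])
      (simp add: \<phi> \<rho>_def \<Phi>_def)
  \<comment> \<open>\<open>Inf\<close> lies below its members only for a set bounded below. Entries
    of a separable state have modulus at most 1, so the sum of the moduli of the entries of
    \<open>?H\<close> gives a bound.\<close>
  moreover have "bdd_below {energy L ?H \<rho> | \<rho>. separable L \<rho>}"
  proof (rule bdd_belowI)
    fix E assume "E \<in> {energy L ?H \<rho> | \<rho>. separable L \<rho>}"
    then obtain \<rho> where E: "E = energy L ?H \<rho>" and "separable L \<rho>" by blast
    then obtain m :: nat and p :: "nat \<Rightarrow> real" and \<theta> :: "nat \<Rightarrow> nat \<Rightarrow> complex ^ 'd"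
      where p: "\<And>i. i < m \<Longrightarrow> 0 \<le> p i" "(\<Sum>i<m. p i) = 1"
        and \<theta>: "\<And>i v. i < m \<Longrightarrow> v \<in> sites L \<Longrightarrow> norm (\<theta> i v) = 1"
        and \<rho>: "\<And>x y. x \<in> configs L \<Longrightarrow> y \<in> configs L \<Longrightarrow> \<rho> x y = (\<Sum>i<m. complex_of_real (p i) *
                       (product_vector L (\<theta> i) x * cnj (product_vector L (\<theta> i) y)))"
      unfolding separable_def by blast
    have pv: "cmod (product_vector L (\<theta> i) x) \<le> 1" if "i < m" for i x
      unfolding product_vector_def
    proof -
      have "cmod (\<theta> i v $ x v) \<le> 1" if "v \<in> sites L" for v
        using Finite_Cartesian_Product.norm_nth_le[of "\<theta> i v" "x v"] \<theta>[OF \<open>i < m\<close> that] by simp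
      then show "cmod (\<Prod>v\<in>sites L. \<theta> i v $ x v) \<le> 1"
        by (simp add: prod_norm[symmetric] prod_le_1)
    qed
    have one: "cmod (\<rho> x y) \<le> 1" if "x \<in> configs L" "y \<in> configs L" for x y
    proof -
      have "cmod (\<rho> x y) \<le> (\<Sum>i<m. p i * (1 * 1))"
        unfolding \<rho>[OF that]
      proof (rule sum_norm_le)
        fix i assume "i \<in> {..<m}"
        then show "cmod (complex_of_real (p i) * (product_vector L (\<theta> i) x * cnj (product_vector L (\<theta> i) y)))
            \<le> p i * (1 * 1)"
          unfolding norm_mult complex_mod_cnj using p(1)[of i] pv[of i]
          by (intro mult_mono) auto
      qed
      then show ?thesis using p(2) by simp
    qed
    have "cmod (\<Sum>x\<in>configs L. \<Sum>y\<in>configs L. ?H x y * \<rho> y x) \<le> (\<Sum>x\<in>configs L. \<Sum>y\<in>configs L. cmod (?H x y) * 1)"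
      by (intro sum_norm_le) (simp add: norm_mult mult_left_le one)
    then show "- (\<Sum>x\<in>configs L. \<Sum>y\<in>configs L. cmod (?H x y) * 1) \<le> E"
      unfolding E energy_def
      using abs_Re_le_cmod[of "\<Sum>x\<in>configs L. \<Sum>y\<in>configs L. ?H x y * \<rho> y x"] by linarith
  qed
  ultimately have "separable_energy L ?H \<le> energy L ?H \<rho>"
    unfolding separable_energy_def by (intro cInf_lower) auto
  also have "energy L ?H \<rho> = Re (\<Sum>x\<in>configs L. cnj (\<Phi> x) * (\<Sum>y\<in>configs L. ?H x y * \<Phi> y))"
    by (simp add: energy_def \<rho>_def sum_distrib_left ac_simps del: Re_sum)
  also have "\<dots> = Re (\<Sum>(a, b)\<in>bond_pairs A L. product_pair_energy h (\<lambda>i. u $ i) (\<lambda>j. w $ j))"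
    unfolding expectation_hamiltonian[OF fin simple]
    by (intro arg_cong[of _ _ Re] sum.cong)
      (auto simp: \<Phi>_def pair_energy_product_vector[OF fin bond_pairs_sites[OF simple] \<phi>], auto simp: \<phi>_def bond_pairs_def)
  finally show ?thesis by simp
qed

text \<open>Exactly one endpoint of each bond lies in \<open>A\<close>, so its orientation is
  unique.\<close>

lemma card_bond_pairs:
  assumes "\<And>e. e \<in> bonds L \<Longrightarrow> \<exists>a\<in>A. \<exists>b. b \<notin> A \<and> e = {a, b}"
  shows "card (bond_pairs A L) = card (bonds L)"
proof (rule bij_betw_same_card)
  show "bij_betw (\<lambda>(a, b). {a, b}) (bond_pairs A L) (bonds L)"
    unfolding bij_betw_def inj_on_def
    using assms by (fastforce simp: bond_pairs_def doubleton_eq_iff image_iff)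
qed

lemma product_pair_energy_scale:
  "product_pair_energy h (\<lambda>i. complex_of_real s * \<phi> i) (\<lambda>j. complex_of_real t * \<theta> j)
    = complex_of_real (s\<^sup>2 * t\<^sup>2) * product_pair_energy h \<phi> \<theta>"
  unfolding product_pair_energy_def sum_distrib_left
  by (intro sum.cong) (auto simp: power2_eq_square)

text \<open>Both sides are homogeneous of degree two in each vector, which reduces nonzero vectors
  to unit vectors; if one vector vanishes, both sides are 0.\<close>

lemma product_pair_energy_ge_of_unit:
  fixes h :: "complex ^ ('d::finite \<times> 'd) ^ ('d \<times> 'd)"
  assumes unit: "\<And>u w :: complex ^ 'd. norm u = 1 \<Longrightarrow> norm w = 1 \<Longrightarrow>
      e \<le> Re (product_pair_energy h (\<lambda>i. u $ i) (\<lambda>j. w $ j))"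
  shows "e * ((\<Sum>i\<in>UNIV. (cmod (\<phi> i))\<^sup>2) * (\<Sum>i\<in>UNIV. (cmod (\<theta> i))\<^sup>2))
    \<le> Re (product_pair_energy h \<phi> \<theta>)"
proof -
  define u :: "complex ^ 'd" where "u = (\<chi> i. \<phi> i)"
  define w :: "complex ^ 'd" where "w = (\<chi> i. \<theta> i)"
  have n: "(\<Sum>i\<in>UNIV. (cmod (\<phi> i))\<^sup>2) = (norm u)\<^sup>2" "(\<Sum>i\<in>UNIV. (cmod (\<theta> i))\<^sup>2) = (norm w)\<^sup>2"
    by (simp_all add: u_def w_def norm_vec_def L2_set_def sum_nonneg)
  show ?thesis
  proof (cases "u = 0 \<or> w = 0")
    case True
    then have "(\<forall>i. \<phi> i = 0) \<or> (\<forall>i. \<theta> i = 0)"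
      by (auto simp: u_def w_def Finite_Cartesian_Product.vec_eq_iff)
    then have "product_pair_energy h \<phi> \<theta> = 0"
      by (auto simp: product_pair_energy_def)
    with True n show ?thesis by auto
  next
    case False
    define s where "s = norm u"
    define t where "t = norm w"
    have st: "s \<noteq> 0" "t \<noteq> 0" using False by (simp_all add: s_def t_def)
    have "e \<le> Re (product_pair_energy h (\<lambda>i. ((1 / s) *\<^sub>R u) $ i) (\<lambda>j. ((1 / t) *\<^sub>R w) $ j))"
      using False by (intro unit) (simp_all add: s_def t_def)
    also have "\<dots> = Re (product_pair_energy h (\<lambda>i. complex_of_real (1 / s) * \<phi> i) (\<lambda>j. complex_of_real (1 / t) * \<theta> j))"
      by (simp only: vector_scaleR_component) (simp add: u_def w_def scaleR_conv_of_real)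
    also have "\<dots> = (1 / s)\<^sup>2 * (1 / t)\<^sup>2 * Re (product_pair_energy h \<phi> \<theta>)"
      unfolding product_pair_energy_scale by simp
    finally have "e * (s\<^sup>2 * t\<^sup>2) \<le> (1 / s)\<^sup>2 * (1 / t)\<^sup>2 * Re (product_pair_energy h \<phi> \<theta>) * (s\<^sup>2 * t\<^sup>2)"
      by (rule mult_right_mono) simp
    also have "\<dots> = Re (product_pair_energy h \<phi> \<theta>)"
      using st by (simp add: field_simps)
    finally show ?thesis unfolding n s_def t_def .
  qed
qed

lemma norm_product_pair_energy_le:
  fixes h :: "complex ^ ('d::finite \<times> 'd) ^ ('d \<times> 'd)" and u w :: "complex ^ 'd"
  assumes "\<And>p q. cmod (h $ p $ q) \<le> M" "0 \<le> M" "norm u = 1" "norm w = 1"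
  shows "cmod (product_pair_energy h (\<lambda>i. u $ i) (\<lambda>j. w $ j)) \<le> M * real CARD('d) ^ 4"
proof -
  have le: "cmod (u $ i) \<le> 1" "cmod (w $ i) \<le> 1" for i
    using Finite_Cartesian_Product.norm_nth_le[of u i] Finite_Cartesian_Product.norm_nth_le[of w i] assms by auto
  let ?f = "\<lambda>(i, i', j, j'). (cnj (u $ i) * u $ i') * (cnj (w $ j) * w $ j')"
  have "cmod (?f q) \<le> 1" for q
    by (cases q) (auto simp: norm_mult intro!: mult_le_one le)
  from norm_quad_sum_le[of h M ?f 1, OF assms(1) this assms(2)] show ?thesis
    by (simp add: product_pair_energy_def)
qed

section \<open>The gap of a finite lattice\<close>

text \<open>The bonds are partitioned into stars centred at the sites of \<open>A\<close>. Each
  centre costs a constant independent of its degree, so the error per bond is governed by the ratio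
  of centres to bonds.\<close>

lemma gap_per_bond_le:
  fixes h :: "complex ^ ('d::finite \<times> 'd) ^ ('d \<times> 'd)"
  assumes fin: "finite (sites L)" and simple: "simple_graph L" and herm: "hermitian_matrix h"
    and bip: "\<And>e. e \<in> bonds L \<Longrightarrow> \<exists>a\<in>A. \<exists>b. b \<notin> A \<and> e = {a, b}"
    and M: "\<And>p q. cmod (h $ p $ q) \<le> M" "0 \<le> M"
    and eta: "0 < \<eta>" and delta: "2 * M * real CARD('d) ^ 4 * sqrt \<eta> \<le> \<delta>"
    and N: "card (bonds L) > 0"
  defines "D \<equiv> real CARD('d) ^ 4"
  shows "gap_per_bond h A L \<le> \<delta> + 2 * M * D / \<eta> * D * real (card (A \<inter> sites L)) / real (card (bonds L))"
proof -
  let ?H = "hamiltonian h A L"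
  define n where "n = real (card (bonds L))"
  have n: "n > 0" using N by (simp add: n_def)
  have cn: "real (card (bond_pairs A L)) = n"
    using card_bond_pairs[OF bip] by (simp add: n_def)
  \<comment> \<open>The separable energy per bond bounds every product pair energy from below, as
    the trial states show; hence it can serve as \<open>e\<close> in the star bound.\<close>
  define e where "e = separable_energy L ?H / n"
  have e_unit: "e \<le> Re (product_pair_energy h (\<lambda>i. u $ i) (\<lambda>j. w $ j))" if "norm u = 1" "norm w = 1"
    for u w :: "complex ^ 'd"
    using separable_energy_le_product[OF fin simple that, of h A] n unfolding cn e_def
    by (simp add: field_simps)
  note e = product_pair_energy_ge_of_unit[OF e_unit]
  have eM: "e \<le> M * real CARD('d) ^ 4"
  proof -
    obtain u :: "complex ^ 'd" where u: "norm u = 1" using vector_choose_size[of 1] by auto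
    show ?thesis
      using e_unit[OF u u] norm_product_pair_energy_le[OF M u u] abs_Re_le_cmod[of "product_pair_energy h (\<lambda>i. u $ i) (\<lambda>j. u $ j)"]
      by linarith
  qed
  define K where "K = 2 * M * D / \<eta>"
  have K: "K \<ge> 0" using M(2) eta by (simp add: K_def D_def)
  define S where "S a = {b. {a, b} \<in> bonds L \<and> b \<notin> A}" for a
  have S: "S a \<subseteq> sites L - {a}" if "a \<in> A" for a
    using simple that by (auto simp: S_def simple_graph_def)
  have finS: "finite (S a)" if "a \<in> A" for a
    using S[OF that] fin finite_subset by blast
  have pairs: "bond_pairs A L = (SIGMA a:A \<inter> sites L. S a)"
    using simple by (auto simp: bond_pairs_def S_def simple_graph_def)
  have finA: "finite (A \<inter> sites L)" using fin by simp
  have cS: "(\<Sum>a\<in>A \<inter> sites L. real (card (S a))) = n"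
    unfolding cn[symmetric] pairs using finA finS by (subst card_SigmaI) auto
  define c where "c = (e - \<delta>) * n - K * D * real (card (A \<inter> sites L))"
  have "c \<le> ground_energy L ?H"
  proof (rule ground_energy_ge[OF fin simple herm])
    fix \<psi> :: "(nat \<Rightarrow> 'd) \<Rightarrow> complex"
    have "c * weight L \<psi> = (\<Sum>a\<in>A \<inter> sites L. (e - \<delta>) * card (S a) * weight L \<psi> - K * (D * weight L \<psi>))"
      unfolding c_def cS[symmetric]
      by (simp add: sum_subtractf sum_distrib_left sum_distrib_right algebra_simps)
    also have "\<dots> \<le> (\<Sum>a\<in>A \<inter> sites L. \<Sum>b\<in>S a. Re (pair_energy h L a b \<psi>))"
    proof (rule sum_mono)
      fix a assume a: "a \<in> A \<inter> sites L"
      \<comment> \<open>The purity of the centre is nonnegative and is discarded; it mattered only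
        inside the induction.\<close>
      have "K * (D * weight L \<psi> - (norm (reduced_matrix L a \<psi>))\<^sup>2 / weight L \<psi>) \<le> K * (D * weight L \<psi>)"
        using K weight_nonneg[of L \<psi>] by (intro mult_left_mono) auto
      moreover have "(e - \<delta>) * card (S a) * weight L \<psi>
          - K * (D * weight L \<psi> - (norm (reduced_matrix L a \<psi>))\<^sup>2 / weight L \<psi>)
          \<le> (\<Sum>b\<in>S a. Re (pair_energy h L a b \<psi>))"
        unfolding K_def D_def using a S
        by (intro star_energy_ge[OF fin _ M e eM eta delta]) auto
      ultimately show "(e - \<delta>) * card (S a) * weight L \<psi> - K * (D * weight L \<psi>)
          \<le> (\<Sum>b\<in>S a. Re (pair_energy h L a b \<psi>))" by linarith
    qed
    also have "\<dots> = (\<Sum>(a, b)\<in>bond_pairs A L. Re (pair_energy h L a b \<psi>))"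
      unfolding pairs using finA finS by (intro sum.Sigma) auto
    also have "\<dots> = Re (\<Sum>(a, b)\<in>bond_pairs A L. pair_energy h L a b \<psi>)"
      by (simp add: case_prod_unfold)
    finally show "c * weight L \<psi> \<le> Re (\<Sum>(a, b)\<in>bond_pairs A L. pair_energy h L a b \<psi>)" .
  qed
  moreover have "separable_energy L ?H = e * n" using n by (simp add: e_def)
  ultimately have "entanglement_gap L ?H \<le> \<delta> * n + K * D * real (card (A \<inter> sites L))"
    by (simp add: entanglement_gap_def c_def algebra_simps)
  then have "gap_per_bond h A L \<le> (\<delta> * n + K * D * real (card (A \<inter> sites L))) / n"
    unfolding gap_per_bond_def n_def[symmetric] using n by (intro divide_right_mono) auto
  also have "\<dots> = \<delta> + K * D * real (card (A \<inter> sites L)) / n"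
    using n by (simp add: add_divide_distrib)
  finally show ?thesis unfolding K_def n_def .
qed

section \<open>Finite regions and their boundaries\<close>

text \<open>Counting of incidences: the \<open>k\<close> bonds at each site of \<open>S\<close> are
  distinct from those at other sites of \<open>S\<close>, and each of them is either inside
  \<open>R\<close> or on its boundary.\<close>

lemma card_sites_le_card_bonds:
  assumes coord: "coordination_number L k" and R: "finite R" "R \<subseteq> sites L"
    and S: "S \<subseteq> R" and indep: "\<And>e. e \<in> bonds L \<Longrightarrow> card (e \<inter> S) \<le> 1"
  shows "k * card S \<le> card (bonds (induced_sublattice L R)) + card (boundary_bonds L R)"
proof -
  let ?I = "\<lambda>v. {e \<in> bonds L. v \<in> e}"
  have finS: "finite S" using R S finite_subset by blast
  have fin: "finite (?I v)" if "v \<in> R" for v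
    using coord R that by (auto simp: coordination_number_def)
  have disj: "?I v \<inter> ?I w = {}" if "v \<in> S" "w \<in> S" "v \<noteq> w" for v w
  proof (rule ccontr)
    assume "?I v \<inter> ?I w \<noteq> {}"
    then obtain e where e: "e \<in> bonds L" "{v, w} \<subseteq> e \<inter> S" using \<open>v \<in> S\<close> \<open>w \<in> S\<close> by auto
    have "card {v, w} \<le> card (e \<inter> S)" using e finS by (intro card_mono) auto
    with indep[OF e(1)] that show False by simp
  qed
  have "k * card S = (\<Sum>v\<in>S. card (?I v))"
    using coord R S by (simp add: coordination_number_def subset_iff)
  also have "\<dots> = card (\<Union>v\<in>S. ?I v)"
    using finS fin S disj by (intro card_UN_disjoint[symmetric]) auto
  also have "\<dots> \<le> card (bonds (induced_sublattice L R) \<union> boundary_bonds L R)"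
  proof (rule card_mono)
    show "finite (bonds (induced_sublattice L R) \<union> boundary_bonds L R)"
    proof (rule finite_subset)
      \<comment> \<open>Graph simplicity is not assumed, so the empty set might be a bond; it would
        lie inside \<open>R\<close> without being incident on a site.\<close>
      show "bonds (induced_sublattice L R) \<union> boundary_bonds L R \<subseteq> insert {} (\<Union>v\<in>R. ?I v)"
        by (auto simp: induced_sublattice_def boundary_bonds_def)
      show "finite (insert {} (\<Union>v\<in>R. ?I v))" using R fin by auto
    qed
    show "(\<Union>v\<in>S. ?I v) \<subseteq> bonds (induced_sublattice L R) \<union> boundary_bonds L R"
      using S by (auto simp: induced_sublattice_def boundary_bonds_def)
  qed
  also have "\<dots> \<le> card (bonds (induced_sublattice L R)) + card (boundary_bonds L R)"
    by (rule card_Un_le)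
  finally show ?thesis .
qed

text \<open>A region is not regular near its boundary, but with few boundary bonds the ratio of
  centres to bonds is still at most \<open>2 / k\<close>.\<close>

lemma gap_per_bond_induced_le:
  fixes h :: "complex ^ ('d::finite \<times> 'd) ^ ('d \<times> 'd)"
  assumes simple: "simple_graph L" and bip: "bipartition L A B" and coord: "coordination_number L k"
    and k: "k > 0" and R: "finite R" "R \<subseteq> sites L"
    and small: "4 * card (boundary_bonds L R) \<le> k * card R"
    and herm: "hermitian_matrix h"
    and M: "\<And>p q. cmod (h $ p $ q) \<le> M" "0 \<le> M"
    and eta: "0 < \<eta>" and delta: "2 * M * real CARD('d) ^ 4 * sqrt \<eta> \<le> \<delta>" and "0 \<le> \<delta>"
  defines "D \<equiv> real CARD('d) ^ 4"
  shows "gap_per_bond h A (induced_sublattice L R) \<le> \<delta> + 2 * M * D / \<eta> * D * 2 / k"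
proof -
  let ?LR = "induced_sublattice L R"
  define n where "n = card (bonds ?LR)"
  have K: "0 \<le> 2 * M * D / \<eta> * D" using M(2) eta by (simp add: D_def)
  show ?thesis
  proof (cases "n = 0")
    case True
    \<comment> \<open>A region without bonds has gap per bond 0 by division by zero.\<close>
    then have "gap_per_bond h A ?LR = 0" by (simp add: gap_per_bond_def n_def)
    moreover have "0 \<le> 2 * M * D / \<eta> * D * 2 / k"
      by (intro divide_nonneg_nonneg mult_nonneg_nonneg[OF K]) auto
    ultimately show ?thesis
      using \<open>0 \<le> \<delta>\<close> by linarith
  next
    case False
    have edges: "\<forall>e\<in>bonds L. \<exists>a\<in>A. \<exists>b\<in>B. e = {a, b}" and disj: "A \<inter> B = {}" and AB: "A \<union> B = sites L"
      using bip by (simp_all add: bipartition_def)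
    have meet: "card (e \<inter> A) \<le> 1" "card (e \<inter> B) \<le> 1" if "e \<in> bonds L" for e
    proof -
      obtain a b where ab: "a \<in> A" "b \<in> B" "e = {a, b}"
        using edges \<open>e \<in> bonds L\<close> by metis
      then have "e \<inter> A = {a}" "e \<inter> B = {b}"
        using disj by auto
      then show "card (e \<inter> A) \<le> 1" "card (e \<inter> B) \<le> 1" by simp_all
    qed
    have sub: "card (e \<inter> (R \<inter> X)) \<le> card (e \<inter> X)" if "e \<in> bonds L" for e X
    proof (rule card_mono)
      have "card e = 2" using simple that unfolding simple_graph_def by blast
      then show "finite (e \<inter> X)" by (metis card.infinite finite_Int zero_neq_numeral)
    qed auto
    have cA: "k * card (R \<inter> A) \<le> n + card (boundary_bonds L R)"
      unfolding n_def by (rule card_sites_le_card_bonds[OF coord R Int_lower1 order_trans[OF sub meet(1)]])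
    have cB: "k * card (R \<inter> B) \<le> n + card (boundary_bonds L R)"
      unfolding n_def by (rule card_sites_le_card_bonds[OF coord R Int_lower1 order_trans[OF sub meet(2)]])
    have "card R = card (R \<inter> A) + card (R \<inter> B)"
      using R disj AB by (subst card_Un_disjoint[symmetric]) (auto intro!: arg_cong[of _ _ card])
    then have "k * card R = k * card (R \<inter> A) + k * card (R \<inter> B)" by (simp add: distrib_left)
    \<comment> \<open>Adding both counts gives \<open>k * card R\<close> at most twice the sum of
      \<open>n\<close> and the number of boundary bonds. With \<open>small\<close>, the latter is at
      most \<open>n\<close>, and \<open>cA\<close> yields the claim.\<close>
    with cA cB small have kA: "k * card (R \<inter> A) \<le> 2 * n" by linarith
    have fin: "finite (sites ?LR)" using R by (simp add: induced_sublattice_def)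
    have simple': "simple_graph ?LR" using simple by (auto simp: simple_graph_def induced_sublattice_def)
    have bip': "\<exists>a\<in>A. \<exists>b. b \<notin> A \<and> e = {a, b}" if "e \<in> bonds ?LR" for e
    proof -
      have "e \<in> bonds L" using that by (simp add: induced_sublattice_def)
      then obtain a b where "a \<in> A" "b \<in> B" "e = {a, b}" using edges by metis
      then show ?thesis using disj by blast
    qed
    have AR: "A \<inter> sites ?LR = R \<inter> A" using R by (auto simp: induced_sublattice_def)
    have "real k * real (card (R \<inter> A)) \<le> 2 * real n"
      using kA by (metis of_nat_le_iff of_nat_mult of_nat_numeral)
    then have "real (card (R \<inter> A)) / real n \<le> 2 / k"
      using k False by (simp add: field_simps)
    then have "2 * M * D / \<eta> * D * (real (card (R \<inter> A)) / real n) \<le> 2 * M * D / \<eta> * D * (2 / k)"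
      using K by (rule mult_left_mono)
    moreover have "gap_per_bond h A ?LR \<le> \<delta> + 2 * M * D / \<eta> * D * real (card (A \<inter> sites ?LR)) / real (card (bonds ?LR))"
      unfolding D_def using False
      by (intro gap_per_bond_le[OF fin simple' herm bip' M eta delta]) (auto simp: n_def)
    ultimately show ?thesis unfolding AR n_def by simp
  qed
qed

text \<open>The gap per bond scales with \<open>h\<close>, so \<open>M\<close> fixes the energy
  scale; \<open>k\<close> is chosen from \<epsilon>, \<open>M\<close> and the spin dimension before
  the coupling and the lattice. Infinite lattices are treated through every admissible sequence of
  finite regions.\<close>

theorem theorem3:
  fixes \<epsilon> M :: real
  assumes "\<epsilon> > 0"
  shows "\<exists>k::nat. k > 0 \<and>
    (\<forall>(h :: complex ^ ('d::finite \<times> 'd) ^ ('d \<times> 'd)) L A B.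
       hermitian_matrix h \<and> norm h \<le> M \<and>
       simple_graph L \<and> bipartition L A B \<and> coordination_number L k \<longrightarrow>
         (finite (sites L) \<longrightarrow> gap_per_bond h A L < \<epsilon>) \<and>
         (\<forall>R. van_hove_exhaustion L R \<longrightarrow>
            limsup (\<lambda>n. ereal (gap_per_bond h A (induced_sublattice L (R n)))) < ereal \<epsilon>))"
proof -
  define D where "D = real CARD('d) ^ 4"
  \<comment> \<open>Strictly positive whatever the sign of \<open>M\<close>, so that \<eta> is a
    quotient by a positive number.\<close>
  define M' where "M' = \<bar>M\<bar> + 1"
  define \<delta> where "\<delta> = \<epsilon> / 4"
  \<comment> \<open>Solves \<open>2 * M' * D * sqrt \<eta> = \<delta>\<close>, the largest threshold
    that the error \<delta> permits.\<close>
  define \<eta> where "\<eta> = (\<delta> / (2 * M' * D))\<^sup>2"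
  define K where "K = 2 * M' * D / \<eta> * D"
  \<comment> \<open>Large enough for \<open>K * 2 / k \<le> \<epsilon> / 4\<close>; the added 1
    keeps \<open>k\<close> positive.\<close>
  define k where "k = nat \<lceil>8 * K / \<epsilon>\<rceil> + 1"
  have pos: "D > 0" "M' > 0" "\<delta> > 0" using assms by (simp_all add: D_def M'_def \<delta>_def)
  then have eta: "\<eta> > 0" by (simp add: \<eta>_def)
  have delta: "2 * M' * D * sqrt \<eta> \<le> \<delta>" using pos by (simp add: \<eta>_def real_sqrt_abs)
  have k: "k > 0" by (simp add: k_def)
  have "8 * K / \<epsilon> \<le> real k" unfolding k_def by linarith
  then have "K * 2 / k \<le> \<epsilon> / 4" using assms k by (simp add: field_simps)
  \<comment> \<open>Half of \<epsilon> is kept in reserve because the limit superior preserves only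
    weak inequalities.\<close>
  then have half: "\<delta> + K * 2 / k \<le> \<epsilon> / 2" by (simp add: \<delta>_def)
  have main: "gap_per_bond h A (induced_sublattice L R) \<le> \<epsilon> / 2"
    if h: "hermitian_matrix h" "norm h \<le> M"
      and L: "simple_graph L" "bipartition L A B" "coordination_number L k"
      and R: "finite R" "R \<subseteq> sites L" "4 * card (boundary_bonds L R) \<le> k * card R"
    for h :: "complex ^ ('d \<times> 'd) ^ ('d \<times> 'd)" and L A B R
  proof -
    have "cmod (h $ p $ q) \<le> M'" for p q
      using Finite_Cartesian_Product.norm_nth_le[of "h $ p" q] Finite_Cartesian_Product.norm_nth_le[of h p] h(2)
      by (simp add: M'_def)
    from gap_per_bond_induced_le[OF L k R h(1) this _ eta delta[unfolded D_def]] pos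
    have "gap_per_bond h A (induced_sublattice L R) \<le> \<delta> + K * 2 / k"
      by (simp add: K_def D_def)
    with half show ?thesis by linarith
  qed
  show ?thesis
  proof (intro exI[of _ k] conjI k allI impI)
    fix h :: "complex ^ ('d \<times> 'd) ^ ('d \<times> 'd)" and L A B
    assume "hermitian_matrix h \<and> norm h \<le> M \<and> simple_graph L \<and> bipartition L A B \<and> coordination_number L k"
    then have hL: "hermitian_matrix h" "norm h \<le> M" "simple_graph L" "bipartition L A B" "coordination_number L k"
      by auto
    show "gap_per_bond h A L < \<epsilon>" if "finite (sites L)"
    proof -
      \<comment> \<open>A finite lattice is a region of itself with no boundary, so the bound for
        regions covers it.\<close>
      have "induced_sublattice L (sites L) = L"
        using hL(3) by (cases L) (auto simp: induced_sublattice_def simple_graph_def)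
      moreover have "boundary_bonds L (sites L) = {}"
        using hL(3) by (auto simp: boundary_bonds_def simple_graph_def)
      ultimately show ?thesis using main[OF hL that] assms by simp
    qed
    fix R assume R: "van_hove_exhaustion L R"
    then have "(\<lambda>n. real (card (boundary_bonds L (R n))) / real (card (R n))) \<longlonglongrightarrow> 0"
      by (simp add: van_hove_exhaustion_def)
    then have "\<forall>\<^sub>F n in sequentially. real (card (boundary_bonds L (R n))) / real (card (R n)) < k / 4"
      using k by (intro order_tendstoD(2)) auto
    then have "\<forall>\<^sub>F n in sequentially. ereal (gap_per_bond h A (induced_sublattice L (R n))) \<le> ereal (\<epsilon> / 2)"
    proof eventually_elim
      case (elim n)
      have Rn: "finite (R n)" "R n \<subseteq> sites L" using R by (auto simp: van_hove_exhaustion_def)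
      have "4 * card (boundary_bonds L (R n)) \<le> k * card (R n)"
      \<comment> \<open>The limit says nothing about an empty region, where the quotient is 0 by
        convention, but such a region has no boundary bonds.\<close>
      proof (cases "R n = {}")
        case False
        then have "card (R n) > 0" using Rn by (simp add: card_gt_0_iff)
        with elim have "real (4 * card (boundary_bonds L (R n))) \<le> real (k * card (R n))"
          by (simp add: field_simps)
        then show ?thesis by (simp only: of_nat_le_iff)
      qed (simp add: boundary_bonds_def)
      from main[OF hL Rn this] show ?case by simp
    qed
    then have "limsup (\<lambda>n. ereal (gap_per_bond h A (induced_sublattice L (R n)))) \<le> ereal (\<epsilon> / 2)"
      by (rule Limsup_bounded)
    also have "\<dots> < ereal \<epsilon>" using assms by simp
    finally show "limsup (\<lambda>n. ereal (gap_per_bond h A (induced_sublattice L (R n)))) < ereal \<epsilon>" .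
  qed
qed

end
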